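(* Let $m,n$ be positive integers with $n\ge m$, and let $$\Theta_2=\sum_{k=1}^\infty (-1)^k\frac{\psi\left(\frac{2k+2n+5}{4}\right)-\psi\left(\frac{2k+2n+3}{4}\right)}{(2k+2m+1)^2}.$$ Then: (i) if $n=m$: $$\Theta_2=(-1)^m\left(-4-4\sum_{k=1}^m\sum_{j=0}^k\frac{(-1)^j}{(2j+1)(2k+1)^2}+\left(1-\frac{\ln^2 2}{4}+\sum_{k=1}^m\frac{1}{(2k+1)^2}\right)\pi-\frac{\pi^3}{8}+4\,\Im(\mathrm{Li}_3(1+i))\right);$$ (ii) if $n=m+1$: $$\Theta_2=(-1)^m\left(\frac{11}{3}+4\sum_{k=1}^m\sum_{j=0}^{k+1}\frac{(-1)^j}{(2j+1)(2k+1)^2}-\frac{3\pi}{2}+\left(\frac{\ln^2 2}{4}-\sum_{k=1}^m\frac{1}{(2k+1)^2}\right)\pi+\frac{\pi^3}{8}+2G-4\,\Im(\mathrm{Li}_3(1+i))\right);$$ (iii) if $n-m$ is odd and $n-m\neq1$: $$\begin{aligned}\Theta_2=(-1)^m\Bigg(&5-\sum_{j=1}^{\frac{n-m-1}{2}}\frac{1}{4j^2(4j+1)}-4\sum_{k=1}^m\sum_{j=0}^{k+n-m}\frac{(-1)^{j+n-m}}{(2j+1)(2k+1)^2}+\frac14\sum_{k=1}^{\frac{n-m-1}{2}}\sum_{j=0}^{2k}\frac{(-1)^j(8k^2+4k+1)}{k^2(2j+1)(2k+1)^2}\\&+4\sum_{j=1}^{n-m}\frac{(-1)^j}{2j+1}+\left(2-\sum_{j=1}^{\frac{n-m-1}{2}}\frac{1}{j(2j+1)}\right)G\\&+\left(\frac{\ln^2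 2}{4}-\frac32+(-1)^{n-m}\sum_{j=1}^m\frac{1}{(2j+1)^2}-\frac12\sum_{j=1}^{\frac{n-m-1}{2}}\frac{1}{(2j+1)^2}\right)\pi+\frac{\pi^3}{8}-4\,\Im(\mathrm{Li}_3(1+i))\Bigg);\end{aligned}$$ (iv) if $n-m$ is even: $$\begin{aligned}\Theta_2=(-1)^m\Bigg(&-4+\frac14\sum_{j=1}^{\frac{n-m}{2}}\frac{1}{j^2(4j-1)}-4\sum_{k=1}^m\sum_{j=0}^{k+n-m}\frac{(-1)^{j+n-m}}{(2j+1)(2k+1)^2}-\frac14\sum_{k=1}^{\frac{n-m}{2}}\sum_{j=0}^{2k-2}\frac{(-1)^j(8k^2-4k+1)}{k^2(2j+1)(2k-1)^2}\\&-4\sum_{j=1}^{n-m}\frac{(-1)^j}{2j+1}+\left(1+(-1)^{n-m}\sum_{j=1}^m\frac{1}{(2j+1)^2}+\frac12\sum_{j=1}^{\frac{n-m}{2}}\frac{1}{(2j-1)^2}\right)\pi\\&-\frac{\pi}{4}\ln^2 2-\frac{\pi^3}{8}-G\sum_{j=1}^{\frac{n-m}{2}}\frac{1}{j(2j-1)}+4\,\Im(\mathrm{Li}_3(1+i))\Bigg).\end{aligned}$$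
   Context: $\psi=\Gamma'/\Gamma$ is the digamma function, $G=\sum_{k=0}^\infty\frac{(-1)^k}{(2k+1)^2}$ is Catalan's constant, and $\mathrm{Li}_3$ is the trilogarithm, $\mathrm{Li}_3(z)=\sum_{k\ge1}z^k/k^3$ for $|z|\le1$, analytically continued to $\mathbb C\setminus[1,\infty)$ (principal branch); $\Im(\mathrm{Li}_3(1+i))\approx1.2670834419$. Empty sums are $0$. *)

theory Defs
  imports "HOL-Complex_Analysis.Complex_Analysis"
begin

definition polylog_series :: "nat \<Rightarrow> complex \<Rightarrow> complex" where
  "polylog_series s z = (\<Sum>k. z ^ Suc k / of_nat (Suc k) ^ s)"

definition slit_plane :: "complex set" where
  "slit_plane = - (complex_of_real ` {1..})"

(* The choice pins trilog down on the slit plane and at 1 (existence: trilog_exists,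
   uniqueness: trilog_unique). On the open half-line (1,\<infinity>) trilog is unspecified. *)
definition trilog :: "complex \<Rightarrow> complex" where
  "trilog = (SOME f. f holomorphic_on slit_plane \<and> (\<forall>z. norm z \<le> 1 \<longrightarrow> f z = polylog_series 3 z))"

definition catalan_const :: real where
  "catalan_const = (\<Sum>k. (-1) ^ k / (2 * real k + 1) ^ 2)"

definition Theta2_term :: "nat \<Rightarrow> nat \<Rightarrow> nat \<Rightarrow> real" where
  "Theta2_term m n k = (-1) ^ k *
     ((Digamma ((2 * real k + 2 * real n + 5) / 4) - Digamma ((2 * real k + 2 * real n + 3) / 4))
        / (2 * real k + 2 * real m + 1) ^ 2)"

definition Theta2 :: "nat \<Rightarrow> nat \<Rightarrow> real" where
  "Theta2 m n = (\<Sum>k. Theta2_term m n (Suc k))"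

lemma Theta2_summable: "summable (\<lambda>k. Theta2_term m n (Suc k))"
proof (rule summable_comparison_test')
  show "summable (\<lambda>k. inverse (real (Suc k) ^ 2))"
    using inverse_power_summable[of 2, where 'a = real]
    by (subst summable_Suc_iff) auto
next
  fix k :: nat
  let ?a = "(2 * real (Suc k) + 2 * real n + 3) / 4"
  let ?b = "(2 * real (Suc k) + 2 * real n + 5) / 4"
  let ?d = "2 * real (Suc k) + 2 * real m + 1"
  have a: "?a \<ge> 1" by (simp add: field_simps)
  have "Digamma ?a \<le> Digamma ?b"
    using a by (intro Digamma_real_mono) (auto simp: field_simps)
  moreover have "Digamma ?b \<le> Digamma (?a + 1)"
    using a by (intro Digamma_real_mono) (auto simp: field_simps)
  moreover have "Digamma (?a + 1) = Digamma ?a + 1 / ?a"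
    using a by (intro Digamma_plus1) auto
  moreover have "1 / ?a \<le> 1" using a by (simp add: divide_le_eq)
  ultimately have d: "\<bar>Digamma ?b - Digamma ?a\<bar> \<le> 1" by linarith
  have "norm (Theta2_term m n (Suc k)) = \<bar>Digamma ?b - Digamma ?a\<bar> / ?d ^ 2"
    unfolding Theta2_term_def
    by (simp only: norm_mult norm_divide norm_power) (simp del: of_nat_Suc power_Suc)
  also have "\<dots> \<le> 1 / real (Suc k) ^ 2"
    using d by (intro frac_le power_mono) auto
  finally show "norm (Theta2_term m n (Suc k)) \<le> inverse (real (Suc k) ^ 2)"
    by (simp only: inverse_eq_divide)
qed

lemma open_slit_plane: "open slit_plane"
proof -
  have "slit_plane = - {z. Im z = 0 \<and> Re z \<ge> 1}"
    by (auto simp: slit_plane_def image_iff complex_eq_iff intro: exI[of _ "Re _"])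
  moreover have "closed {z. Im z = 0 \<and> Re z \<ge> 1}"
    by (intro closed_Collect_conj closed_Collect_eq closed_Collect_le continuous_intros)
  ultimately show ?thesis by (metis open_Compl)
qed

lemma ball_subset_slit_plane: "ball 0 1 \<subseteq> slit_plane"
  by (auto simp: slit_plane_def)

lemma starlike_slit_plane: "starlike slit_plane"
  unfolding starlike_def
proof (intro bexI[of _ 0] ballI subsetI)
  show "0 \<in> slit_plane" using ball_subset_slit_plane by auto
  fix x y assume x: "x \<in> slit_plane" and "y \<in> closed_segment 0 x"
  then obtain u where u: "0 \<le> u" "u \<le> 1" "y = of_real u * x"
    by (auto simp: in_segment scaleR_conv_of_real)
  show "y \<in> slit_plane"
  proof (rule ccontr)
    assume "y \<notin> slit_plane"
    then obtain r where r: "r \<ge> 1" "of_real u * x = of_real r"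
      using u by (auto simp: slit_plane_def)
    have "u > 0" using r u by (cases "u = 0") auto
    hence "x = of_real (r / u)" using r by (simp add: field_simps)
    moreover have "r / u \<in> {1..}" using r u \<open>u > 0\<close> by (simp add: field_simps)
    ultimately have "x \<in> complex_of_real ` {1..}" by (rule image_eqI)
    thus False using x by (simp add: slit_plane_def)
  qed
qed

lemma summable_polylog_coeffs:
  assumes "norm z < 1"
  shows "summable (\<lambda>k. (1 / of_nat (Suc k) ^ s) * z ^ k :: complex)"
proof (rule summable_comparison_test')
  show "summable (\<lambda>k. norm z ^ k)" using assms by (simp add: summable_geometric)
  fix k :: nat
  have "norm ((1 / of_nat (Suc k) ^ s) * z ^ k) = norm z ^ k / real (Suc k) ^ s"
    by (simp add: norm_mult norm_divide norm_power del: of_nat_Suc)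
  also have "\<dots> \<le> norm z ^ k / 1"
    by (intro divide_left_mono) (auto intro: one_le_power)
  finally show "norm ((1 / of_nat (Suc k) ^ s) * z ^ k) \<le> norm z ^ k" by simp
qed

lemma polylog_series_eq:
  assumes "norm z < 1"
  shows "polylog_series s z = z * (\<Sum>k. (1 / of_nat (Suc k) ^ s) * z ^ k)"
  unfolding polylog_series_def
  by (subst suminf_mult[OF summable_polylog_coeffs[OF assms], symmetric]) simp

lemma polylog_series_deriv:
  assumes "norm z < 1"
  shows "(polylog_series (Suc s) has_field_derivative
           (\<Sum>k. (1 / of_nat (Suc k) ^ s) * z ^ k)) (at z)"
proof -
  define c :: "nat \<Rightarrow> complex" where "c k = (if k = 0 then 0 else 1 / of_nat k ^ Suc s)" for k
  have sm: "summable (\<lambda>k. c k * w ^ k)" if "norm w < 1" for w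
  proof (rule summable_Suc_iff[THEN iffD1])
    have "summable (\<lambda>k. w * ((1 / of_nat (Suc k) ^ Suc s) * w ^ k))"
      by (intro summable_mult summable_polylog_coeffs that)
    thus "summable (\<lambda>k. c (Suc k) * w ^ Suc k)" by (simp add: c_def mult_ac del: of_nat_Suc)
  qed
  have eq: "polylog_series (Suc s) w = (\<Sum>k. c k * w ^ k)" if "norm w < 1" for w
    using suminf_split_head[OF sm[OF that]]
    by (simp add: c_def polylog_series_def del: of_nat_Suc power_Suc)
  have "((\<lambda>w. \<Sum>k. c k * w ^ k) has_field_derivative (\<Sum>k. diffs c k * z ^ k)) (at z)"
    by (rule termdiffs_strong'[of 1]) (use sm assms in auto)
  moreover have "diffs c k = 1 / of_nat (Suc k) ^ s" for k
    by (simp add: diffs_def c_def del: of_nat_Suc)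
  ultimately have "((\<lambda>w. \<Sum>k. c k * w ^ k) has_field_derivative
      (\<Sum>k. (1 / of_nat (Suc k) ^ s) * z ^ k)) (at z)" by simp
  thus ?thesis
    by (rule has_field_derivative_transform_within_open[of _ _ _ "ball 0 1"])
       (use assms eq in auto)
qed

lemma polylog_continuation_ball:
  "\<exists>f. f holomorphic_on slit_plane \<and> (\<forall>z\<in>ball 0 1. f z = polylog_series s z)"
proof (induction s)
  case 0
  have "1 - z \<noteq> 0" if "z \<in> slit_plane" for z
    using that by (auto simp: slit_plane_def)
  hence "(\<lambda>z. z / (1 - z)) holomorphic_on slit_plane" by (intro holomorphic_intros) auto
  moreover have "z / (1 - z) = polylog_series 0 z" if "z \<in> ball 0 1" for z
    using that suminf_geometric[of z] by (subst polylog_series_eq) auto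
  ultimately show ?case by blast
next
  case (Suc s)
  then obtain f where f: "f holomorphic_on slit_plane"
    "\<And>z. z \<in> ball 0 1 \<Longrightarrow> f z = polylog_series s z" by blast
  let ?q = "\<lambda>z. \<Sum>k. (1 / of_nat (Suc k) ^ s) * z ^ k :: complex"
  define g where "g z = (if z = 0 then ?q 0 else f z / z)" for z
  have gq: "g z = ?q z" if "z \<in> ball 0 1" for z
    using that f(2)[OF that] polylog_series_eq[of z s] by (auto simp: g_def)
  have "g holomorphic_on ball 0 1"
  proof -
    have "?q holomorphic_on ball 0 1"
      by (rule power_series_holomorphic[where a = "\<lambda>k. 1 / of_nat (Suc k) ^ s"])
         (use summable_sums[OF summable_polylog_coeffs] in auto)
    thus ?thesis using gq by (subst holomorphic_cong[OF refl]) auto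
  qed
  moreover have "g holomorphic_on (slit_plane - {0})"
  proof -
    have "(\<lambda>z. f z / z) holomorphic_on (slit_plane - {0})"
      by (intro holomorphic_intros holomorphic_on_subset[OF f(1)]) auto
    thus ?thesis by (subst holomorphic_cong[OF refl]) (auto simp: g_def)
  qed
  ultimately have "g holomorphic_on (ball 0 1 \<union> (slit_plane - {0}))"
    using open_slit_plane by (intro holomorphic_on_Un) auto
  moreover have "ball 0 1 \<union> (slit_plane - {0}) = slit_plane"
    using ball_subset_slit_plane by auto
  ultimately have g: "g holomorphic_on slit_plane" by simp
  obtain F where F: "\<And>z. z \<in> slit_plane \<Longrightarrow> (F has_field_derivative g z) (at z)"
    using holomorphic_starlike_primitive[OF holomorphic_on_imp_continuous_on[OF g]
            starlike_slit_plane open_slit_plane finite.emptyI] g open_slit_plane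
    by (auto simp: holomorphic_on_open field_differentiable_def)
  have "\<exists>c. \<forall>z\<in>ball 0 1. F z - polylog_series (Suc s) z = c"
  proof (rule has_field_derivative_zero_constant)
    fix z :: complex assume z: "z \<in> ball 0 1"
    have "(F has_field_derivative g z) (at z)" using z ball_subset_slit_plane F by blast
    hence "((\<lambda>z. F z - polylog_series (Suc s) z) has_field_derivative g z - ?q z) (at z)"
      using z by (intro DERIV_diff polylog_series_deriv) auto
    thus "((\<lambda>z. F z - polylog_series (Suc s) z) has_field_derivative 0) (at z within ball 0 1)"
      using gq[OF z] by (simp add: has_field_derivative_at_within)
  qed auto
  then obtain c where c: "\<And>z. z \<in> ball 0 1 \<Longrightarrow> F z - polylog_series (Suc s) z = c" by blast
  have "F holomorphic_on slit_plane"
    using F open_slit_plane by (auto simp: holomorphic_on_open)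
  hence "(\<lambda>z. F z - c) holomorphic_on slit_plane" by (intro holomorphic_intros)
  moreover have "F z - c = polylog_series (Suc s) z" if "z \<in> ball 0 1" for z
    using c[OF that] by (simp add: algebra_simps)
  ultimately show ?case by blast
qed

lemma continuous_on_polylog_series:
  assumes "s \<ge> 2"
  shows "continuous_on (cball 0 1) (polylog_series s)"
proof -
  have "uniform_limit (cball 0 1) (\<lambda>n z. \<Sum>k<n. z ^ Suc k / of_nat (Suc k) ^ s :: complex)
          (polylog_series s) sequentially"
    unfolding polylog_series_def[abs_def]
  proof (rule Weierstrass_m_test)
    show "summable (\<lambda>k. inverse (real (Suc k) ^ s))"
      using inverse_power_summable[of s, where 'a = real] assms
      by (subst summable_Suc_iff) auto
    fix k :: nat and z :: complex assume "z \<in> cball 0 1"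
    hence "norm z ^ Suc k / real (Suc k) ^ s \<le> 1 / real (Suc k) ^ s"
      by (intro divide_right_mono power_le_one) auto
    thus "norm (z ^ Suc k / of_nat (Suc k) ^ s) \<le> inverse (real (Suc k) ^ s)"
      by (simp add: norm_divide norm_power norm_mult inverse_eq_divide del: of_nat_Suc)
  qed
  thus ?thesis
    by (rule uniform_limit_theorem[rotated])
       (auto intro!: always_eventually continuous_intros simp del: of_nat_Suc)
qed

lemma trilog_exists:
  "\<exists>f. f holomorphic_on slit_plane \<and> (\<forall>z. norm z \<le> 1 \<longrightarrow> f z = polylog_series 3 z)"
proof -
  obtain f where f: "f holomorphic_on slit_plane"
    "\<And>z. z \<in> ball 0 1 \<Longrightarrow> f z = polylog_series 3 z"
    using polylog_continuation_ball[of 3] by blast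
  have eq: "f z = polylog_series 3 z" if z: "norm z \<le> 1" "z \<in> slit_plane" for z
  proof -
    define w where "w n = of_real (1 - inverse (real (Suc n))) * z" for n
    have "(\<lambda>n. of_real (1 - inverse (real (Suc n))) * z) \<longlonglongrightarrow> of_real (1 - 0) * z"
      by (intro tendsto_intros LIMSEQ_inverse_real_of_nat)
    hence w: "w \<longlonglongrightarrow> z" by (simp add: w_def[abs_def])
    have wb: "w n \<in> ball 0 1" for n
    proof -
      have "norm (w n) = (1 - inverse (real (Suc n))) * norm z"
        unfolding w_def norm_mult norm_of_real by (simp add: field_simps)
      also have "\<dots> \<le> (1 - inverse (real (Suc n))) * 1"
        using z by (intro mult_left_mono) (auto simp: field_simps)
      also have "\<dots> < 1" by simp
      finally show ?thesis by simp
    qed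
    have "(\<lambda>n. polylog_series 3 (w n)) \<longlonglongrightarrow> polylog_series 3 z"
      using continuous_on_tendsto_compose[OF continuous_on_polylog_series[of 3] w] wb z
      by (simp add: less_imp_le)
    moreover have "(\<lambda>n. f (w n)) \<longlonglongrightarrow> f z"
      using continuous_on_tendsto_compose[OF holomorphic_on_imp_continuous_on[OF f(1)] w] wb z
        ball_subset_slit_plane by (simp add: subset_iff)
    ultimately show ?thesis using f(2)[OF wb] by (simp add: LIMSEQ_unique)
  qed
  have "(\<lambda>z. if z \<in> slit_plane then f z else polylog_series 3 z) holomorphic_on slit_plane"
    using f(1) by (subst holomorphic_cong[OF refl, of _ _ f]) auto
  thus ?thesis using eq
    by (intro exI[of _ "\<lambda>z. if z \<in> slit_plane then f z else polylog_series 3 z"]) auto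
qed

lemma trilog_holomorphic: "trilog holomorphic_on slit_plane"
  and trilog_series: "norm z \<le> 1 \<Longrightarrow> trilog z = polylog_series 3 z"
  using someI_ex[OF trilog_exists] by (auto simp: trilog_def)

lemma trilog_unique:
  assumes "f holomorphic_on slit_plane" "\<And>z. norm z < 1 \<Longrightarrow> f z = polylog_series 3 z"
    and "z \<in> slit_plane"
  shows "f z = trilog z"
proof (rule analytic_continuation_open[of "ball 0 1" slit_plane f trilog])
  show "connected slit_plane"
    using starlike_imp_connected[OF starlike_slit_plane] .
qed (use assms open_slit_plane ball_subset_slit_plane trilog_holomorphic trilog_series in auto)

end

theory Submission
  imports Defs
begin

text \<open>
  The recurrence \<open>\<psi>(x + 1) = \<psi>(x) + 1 / x\<close> turns the digamma differences into tails of Leibniz' series,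
  so with \<open>d = n - m\<close> the sum reduces, up to finitely many terms, to
  \<open>S d = (\<Sum>k. A (k + 1 + d) / (2 k + 1)\<^sup>2)\<close>, where \<open>A N = (\<Sum>i\<ge>N. (-1)^i / (2 i + 1))\<close>.
  Partial fractions express \<open>S (d + 1) - S d\<close> by \<open>G\<close>, \<open>\<pi>\<close> and \<open>A (d + 1)\<close>; two such
  steps at a time give the sums over \<open>j\<close> and \<open>k\<close> in the statement.

  For \<open>S 0\<close>, replace \<open>A N\<close> by the tail of the arctangent series at \<open>x\<close>. The derivative of the
  resulting series in \<open>x\<close> is \<open>- x / (1 + x\<^sup>2) * Im (Li\<^sub>2 (\<i> x))\<close>. Integration by parts leaves
  the integral of \<open>ln (1 + x\<^sup>2) * arctan x / x = Im (Ln (1 + \<i> x)\<^sup>2) / x\<close>, and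
  \<open>Ln (1 - z) * (Ln z)\<^sup>2 + 2 * Ln z * Li\<^sub>2 z - 2 * Li\<^sub>3 z\<close> is a primitive of
  \<open>- (Ln z)\<^sup>2 / (1 - z)\<close>; its value at \<open>1 + \<i>\<close> follows from the reflection formula for \<open>Li\<^sub>2\<close>.
\<close>

subsection \<open>Reduction to a series of arctangent tails\<close>

text \<open>For \<open>\<bar>x\<bar> \<le> 1\<close> this is the remainder of the arctangent series
  from index \<open>N\<close> on. Writing it as \<open>arctan\<close> minus a partial sum gives
  values, recurrence and derivative without any convergence argument.\<close>

definition arctan_tail :: "nat \<Rightarrow> real \<Rightarrow> real" where
  "arctan_tail N x = arctan x - (\<Sum>i<N. (-1) ^ i * x ^ (2 * i + 1) / (2 * real i + 1))"

definition tail_sum :: "nat \<Rightarrow> real" where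
  "tail_sum d = (\<Sum>k. arctan_tail (k + 1 + d) 1 / (2 * real k + 1) ^ 2)"

lemma arctan_tail_Suc:
  "arctan_tail (Suc N) x = arctan_tail N x - (-1) ^ N * x ^ (2 * N + 1) / (2 * real N + 1)"
  by (simp add: arctan_tail_def)

lemma arctan_tail_at_0 [simp]: "arctan_tail N 0 = 0"
  by (simp add: arctan_tail_def)

text \<open>Termwise, this is 1/(1 + x^2) minus the first \<open>N\<close> terms of the geometric
  series with ratio -x^2, so the remainder is again geometric. In the induction step one more power
  of -x^2 is removed.\<close>

lemma arctan_tail_deriv:
  "(arctan_tail N has_real_derivative (- (x ^ 2)) ^ N / (1 + x ^ 2)) (at x)"
proof (induction N)
  case 0
  have "(arctan has_real_derivative inverse (1 + x ^ 2)) (at x)"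
    by (rule DERIV_arctan)
  then show ?case by (simp add: arctan_tail_def[abs_def] inverse_eq_divide)
next
  case (Suc N)
  have pos: "1 + x ^ 2 \<noteq> 0" using zero_le_power2[of x] by linarith
  have "((\<lambda>x. (-1) ^ N * x ^ (2 * N + 1) / (2 * real N + 1)) has_real_derivative
          (-1) ^ N * (real (2 * N + 1) * x ^ (2 * N)) / (2 * real N + 1)) (at x)"
    using DERIV_pow[of "2 * N + 1" x]
    by (intro DERIV_cdivide DERIV_cmult) simp
  then have "((\<lambda>x. arctan_tail N x - (-1) ^ N * x ^ (2 * N + 1) / (2 * real N + 1))
      has_real_derivative (- (x ^ 2)) ^ N / (1 + x ^ 2) -
          (-1) ^ N * (real (2 * N + 1) * x ^ (2 * N)) / (2 * real N + 1)) (at x)"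
    by (intro DERIV_diff Suc)
  also have "(-1) ^ N * (real (2 * N + 1) * x ^ (2 * N)) / (2 * real N + 1) = (- (x ^ 2)) ^ N"
  proof -
    have "(- (x ^ 2)) ^ N = (-1) ^ N * x ^ (2 * N)"
      by (simp only: power_minus[of "x ^ 2"] power_mult)
    then show ?thesis by (simp add: field_simps)
  qed
  also have "(- (x ^ 2)) ^ N / (1 + x ^ 2) - (- (x ^ 2)) ^ N = (- (x ^ 2)) ^ Suc N / (1 + x ^ 2)"
    using pos by (simp add: field_simps)
  finally show ?case by (simp add: arctan_tail_Suc[abs_def])
qed

text \<open>The derivative has absolute value at most 1 on the unit interval and the tail vanishes
  at 0. The bound is uniform in \<open>N\<close>, which is what makes \<open>tail_sum\<close>
  comparable with the sum of inverse odd squares.\<close>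

lemma abs_arctan_tail_le:
  assumes "0 \<le> x" "x \<le> 1"
  shows "\<bar>arctan_tail N x\<bar> \<le> 1"
proof -
  have "norm (arctan_tail N x - arctan_tail N 0) \<le> 1 * norm (x - 0)"
  proof (rule field_differentiable_bound[where S = "{0..1}"])
    fix z :: real assume z: "z \<in> {0..1}"
    show "(arctan_tail N has_real_derivative (- (z ^ 2)) ^ N / (1 + z ^ 2)) (at z within {0..1})"
      by (rule has_field_derivative_at_within[OF arctan_tail_deriv])
    have "\<bar>(- (z ^ 2)) ^ N\<bar> \<le> 1"
      using z by (simp add: power_abs power_le_one)
    then show "norm ((- (z ^ 2)) ^ N / (1 + z ^ 2)) \<le> 1"
      by (simp add: abs_divide divide_le_eq add_nonneg_nonneg) (smt (verit) zero_le_power2)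
  qed (use assms in auto)
  then show ?thesis using assms by simp
qed

lemma summable_odd_squares: "summable (\<lambda>k. 1 / (2 * real k + 1) ^ 2)"
proof (rule summable_comparison_test')
  show "summable (\<lambda>k. inverse (real (Suc k) ^ 2))"
    using inverse_power_summable[of 2, where 'a = real]
    by (subst summable_Suc_iff) auto
  fix k :: nat
  show "norm (1 / (2 * real k + 1) ^ 2) \<le> inverse (real (Suc k) ^ 2)"
    by (simp add: inverse_eq_divide frac_le power_mono)
qed

lemma summable_tail_sum: "summable (\<lambda>k. arctan_tail (k + 1 + d) 1 / (2 * real k + 1) ^ 2)"
proof (rule summable_comparison_test'[OF summable_odd_squares])
  fix k
  show "norm (arctan_tail (k + 1 + d) 1 / (2 * real k + 1) ^ 2) \<le> 1 / (2 * real k + 1) ^ 2"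
    using abs_arctan_tail_le[of 1 "k + 1 + d"] by (simp add: divide_right_mono)
qed

lemma arctan_tail_1_tendsto_0: "(\<lambda>N. arctan_tail N 1) \<longlonglongrightarrow> 0"
proof -
  have "(\<lambda>k. (-1) ^ k * (1 / real (k * 2 + 1) * 1 ^ (k * 2 + 1))) sums arctan 1"
    using summable_arctan_series[of 1] arctan_series[of 1] by (simp add: sums_iff)
  then have "(\<lambda>N. \<Sum>i<N. (-1) ^ i * 1 ^ (2 * i + 1) / (2 * real i + 1)) \<longlonglongrightarrow> arctan 1"
    by (simp add: sums_def ac_simps)
  then show ?thesis
    unfolding arctan_tail_def[abs_def] by (auto intro: tendsto_eq_intros)
qed

lemma arctan_tail_sums:
  "(\<lambda>k. (-1) ^ (k + N) / (2 * real (k + N) + 1)) sums arctan_tail N 1"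
proof -
  have "(\<lambda>k. arctan_tail (k + N) 1) \<longlonglongrightarrow> 0"
    using arctan_tail_1_tendsto_0 by (rule LIMSEQ_ignore_initial_segment)
  from telescope_sums'[OF this] show ?thesis by (simp add: arctan_tail_Suc)
qed

text \<open>The two arguments differ by 1/2, so the sum of two consecutive differences telescopes to
  psi(x + 1) - psi(x) = 1/x with x = (2N + 1)/4. Up to the factor 4 and an alternating sign,
  \<open>arctan_tail N 1\<close> obeys the same recurrence, so the difference of the two sequences
  is constant. Both tend to 0: the digamma differences are nonnegative, so the recurrence bounds
  each by 4/(2N + 1).\<close>

lemma Digamma_diff:
  "Digamma ((2 * real N + 3) / 4) - Digamma ((2 * real N + 1) / 4) = 4 * (-1) ^ N * arctan_tail N 1"
proof -
  define \<delta> where "\<delta> N = Digamma ((2 * real N + 3) / 4) - Digamma ((2 * real N + 1) / 4)" for N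
  have rec: "\<delta> N + \<delta> (Suc N) = 4 / (2 * real N + 1)" for N
  proof -
    have e: "(2 * real N + 1) / 4 + 1 = (2 * real (Suc N) + 3) / 4"
      "(2 * real (Suc N) + 1) / 4 = (2 * real N + 3) / 4" by (simp_all add: field_simps)
    have D: "Digamma ((2 * real N + 1) / 4 + 1) = Digamma ((2 * real N + 1) / 4) + 1 / ((2 * real N + 1) / 4)"
      by (rule Digamma_plus1) auto
    show ?thesis unfolding \<delta>_def e(2) D[unfolded e(1)] by simp
  qed
  have nonneg: "\<delta> N \<ge> 0" for N
    using Digamma_real_mono[of "(2 * real N + 1) / 4" "(2 * real N + 3) / 4"]
    by (simp add: \<delta>_def)
  have lim: "\<delta> \<longlonglongrightarrow> 0"
  proof (rule tendsto_sandwich[of "\<lambda>_. 0" \<delta> sequentially "\<lambda>N. 4 / (2 * real N + 1)"])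
    show "\<forall>\<^sub>F N in sequentially. \<delta> N \<le> 4 / (2 * real N + 1)"
      using rec nonneg by (intro always_eventually allI) (smt (verit))
    show "(\<lambda>N. 4 / (2 * real N + 1)) \<longlonglongrightarrow> 0"
      by real_asymp
  qed (use nonneg in auto)
  have const: "(-1) ^ N * \<delta> N - 4 * arctan_tail N 1 = \<delta> 0 - 4 * arctan_tail 0 1" for N
  proof (induction N)
    case (Suc N)
    have "(-1) ^ Suc N * \<delta> (Suc N) = (-1) ^ N * \<delta> N - (-1) ^ N * (\<delta> N + \<delta> (Suc N))"
      by (simp add: algebra_simps)
    then show ?case using Suc by (simp add: rec arctan_tail_Suc)
  qed simp
  have "(\<lambda>N. \<bar>(-1) ^ N * \<delta> N\<bar>) \<longlonglongrightarrow> 0"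
    using tendsto_rabs[OF lim] by (simp add: abs_mult power_abs)
  then have "(\<lambda>N. (-1) ^ N * \<delta> N - 4 * arctan_tail N 1) \<longlonglongrightarrow> 0 - 4 * 0"
    by (intro tendsto_intros arctan_tail_1_tendsto_0) (simp add: tendsto_rabs_zero_iff)
  then have "\<delta> 0 - 4 * arctan_tail 0 1 = 0"
    unfolding const by (simp add: LIMSEQ_const_iff)
  with const[of N] have "(-1) ^ N * \<delta> N = 4 * arctan_tail N 1" by simp
  then have "(-1) ^ N * ((-1) ^ N * \<delta> N) = 4 * (-1) ^ N * arctan_tail N 1" by simp
  then show ?thesis by (simp add: \<delta>_def mult.assoc[symmetric] power_add[symmetric])
qed

text \<open>The sign (-1)^N in \<open>Digamma_diff\<close> cancels the alternation of the series and
  leaves a constant sign. The odd denominators start at 2m + 3, so the series is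
  \<open>tail_sum d\<close> without its first m + 1 terms.\<close>

lemma Theta2_eq_tail_sum:
  "Theta2 m (m + d) = 4 * (-1) ^ (m + d + 1) *
     (tail_sum d - (\<Sum>k=0..m. arctan_tail (k + 1 + d) 1 / (2 * real k + 1) ^ 2))"
proof -
  let ?f = "\<lambda>k. arctan_tail (k + 1 + d) 1 / (2 * real k + 1) ^ 2"
  have "Theta2_term m (m + d) (Suc k) = 4 * (-1) ^ (m + d + 1) * ?f (k + Suc m)" for k
  proof -
    have "2 * real (Suc k) + 2 * real (m + d) + 5 = 2 * real (k + m + d + 2) + 3"
      "2 * real (Suc k) + 2 * real (m + d) + 3 = 2 * real (k + m + d + 2) + 1"
      "2 * real (Suc k) + 2 * real m + 1 = 2 * real (k + Suc m) + 1" by simp_all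
    moreover have "(-1) ^ Suc k * (-1) ^ (k + m + d + 2) = ((-1) ^ (m + d + 1) :: real)"
      by (simp add: power_add)
    moreover have "k + Suc m + 1 + d = k + m + d + 2" by simp
    ultimately show ?thesis
      unfolding Theta2_term_def by (simp only: Digamma_diff) (simp add: mult_ac)
  qed
  then have "Theta2 m (m + d) = 4 * (-1) ^ (m + d + 1) * (\<Sum>k. ?f (k + Suc m))"
    unfolding Theta2_def
    by (simp only:) (rule suminf_mult, rule summable_ignore_initial_segment[OF summable_tail_sum])
  also have "(\<Sum>k. ?f (k + Suc m)) = tail_sum d - (\<Sum>k<Suc m. ?f k)"
    using suminf_split_initial_segment[OF summable_tail_sum, of d "Suc m"]
    unfolding tail_sum_def by linarith
  also have "{..<Suc m} = {0..m}" by auto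
  finally show ?thesis .
qed

section \<open>The recurrence of the tail sums in the shift d\<close>

lemma catalan_sums: "(\<lambda>k. (-1) ^ k / (2 * real k + 1) ^ 2) sums catalan_const"
  unfolding catalan_const_def
  by (rule summable_sums, rule summable_comparison_test'[OF summable_odd_squares])
     (simp add: abs_mult power_abs)

text \<open>Termwise, raising \<open>d\<close> removes the term of Leibniz' series with denominator
  x + c, where x = 2k + 1 and c = 2(d + 1). Splitting 1/((x + c) x^2) into partial fractions in x
  gives three series: Catalan's, Leibniz' with value pi/4, and the tail of Leibniz' series from
  index d + 1.\<close>

lemma tail_sum_Suc:
  "tail_sum (Suc d) = tail_sum d + (-1) ^ d * (catalan_const / (2 * (real d + 1))
      - pi / (16 * (real d + 1) ^ 2))
      - arctan_tail (Suc d) 1 / (4 * (real d + 1) ^ 2)"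
proof -
  define c where "c = 2 * (real d + 1)"
  have c: "c > 0" by (simp add: c_def)
  have eq: "arctan_tail (k + 1 + Suc d) 1 / (2 * real k + 1) ^ 2 -
        arctan_tail (k + 1 + d) 1 / (2 * real k + 1) ^ 2 =
      (-1) ^ d * ((-1) ^ k / (2 * real k + 1) ^ 2 / c - (-1) ^ k / (2 * real k + 1) / c ^ 2)
       - (-1) ^ (k + Suc d) / (2 * real (k + Suc d) + 1) / c ^ 2" for k
  proof -
    define x where "x = 2 * real k + 1"
    have x: "x > 0" by (simp add: x_def)
    have "2 * real (k + Suc d) + 1 = x + c" by (simp add: x_def c_def)
    moreover have pf: "s / ((x + c) * x ^ 2) = s / (x ^ 2 * c) - s / (x * c ^ 2) + s / ((x + c) * c ^ 2)" for s
    proof -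
      have "x \<noteq> 0" "c \<noteq> 0" "x + c \<noteq> 0" using x c by auto
      then show ?thesis by (simp add: divide_simps) algebra
    qed
    moreover have "arctan_tail (k + 1 + Suc d) 1 =
        arctan_tail (k + 1 + d) 1 + (-1) ^ d * (-1) ^ k / (2 * real (k + Suc d) + 1)"
      using arctan_tail_Suc[of "k + 1 + d" 1] by (simp add: power_add)
    ultimately show ?thesis unfolding x_def[symmetric]
      by (simp only: power_add power_Suc add_divide_distrib distrib_left right_diff_distrib)
        (simp add: pf mult.commute[of "(-1) ^ k"])
  qed
  have "(\<lambda>k. arctan_tail (k + 1 + Suc d) 1 / (2 * real k + 1) ^ 2 -
        arctan_tail (k + 1 + d) 1 / (2 * real k + 1) ^ 2) sums (tail_sum (Suc d) - tail_sum d)"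
    unfolding tail_sum_def by (intro sums_diff summable_sums summable_tail_sum)
  moreover have "(\<lambda>k. (-1) ^ d * ((-1) ^ k / (2 * real k + 1) ^ 2 / c - (-1) ^ k / (2 * real k + 1) / c ^ 2)
       - (-1) ^ (k + Suc d) / (2 * real (k + Suc d) + 1) / c ^ 2) sums
     ((-1) ^ d * (catalan_const / c - arctan_tail 0 1 / c ^ 2) - arctan_tail (Suc d) 1 / c ^ 2)"
    using arctan_tail_sums[of 0]
    by (intro sums_diff sums_mult sums_divide catalan_sums arctan_tail_sums) simp
  ultimately have "tail_sum (Suc d) - tail_sum d =
      (-1) ^ d * (catalan_const / c - arctan_tail 0 1 / c ^ 2) - arctan_tail (Suc d) 1 / c ^ 2"
    unfolding eq by (rule sums_unique2)
  moreover have "c ^ 2 = 4 * (real d + 1) ^ 2" by (simp only: c_def power_mult_distrib) simp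
  moreover have "arctan_tail 0 1 = pi / 4" by (simp add: arctan_tail_def arctan_one)
  ultimately show ?thesis by (simp add: c_def)
qed

lemma arctan_tail_1_eq:
  "arctan_tail N 1 = pi / 4 - (\<Sum>i<N. (-1) ^ i / (2 * real i + 1))"
  by (simp add: arctan_tail_def arctan_one)

text \<open>Each induction step applies \<open>tail_sum_Suc\<close> twice, with x = h + 1. The
  numerator 8x^2 - 4x + 1 is (2x)^2 + (2x - 1)^2, from adding the coefficients 1/(2x - 1)^2 and
  1/(2x)^2 of the common partial sum \<open>P\<close>. The second tail has one further term 1/(4x -
  1), which produces the single sum over \<open>j\<close>. The contributions of pi over (2x)^2
  cancel, so only odd squares remain.\<close>

lemma tail_sum_even:
  "- 4 * tail_sum (2 * h) = - 4 * tail_sum 0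
     + 1 / 4 * (\<Sum>j=1..h. 1 / (real j ^ 2 * (4 * real j - 1)))
     - 1 / 4 * (\<Sum>k=1..h. \<Sum>j=0..2*k-2. (-1) ^ j * (8 * real k ^ 2 - 4 * real k + 1)
           / (real k ^ 2 * (2 * real j + 1) * (2 * real k - 1) ^ 2))
     + 1 / 2 * (\<Sum>j=1..h. 1 / (2 * real j - 1) ^ 2) * pi
     - catalan_const * (\<Sum>j=1..h. 1 / (real j * (2 * real j - 1)))"
proof (induction h)
  case (Suc h)
  define x where "x = real (Suc h)"
  have x: "x \<ge> 1" by (simp add: x_def)
  define P where "P = (\<Sum>j=0..2*h. (-1) ^ j / (2 * real j + 1) :: real)"
  have tail: "arctan_tail (Suc (2 * h)) 1 = pi / 4 - P"
    by (simp add: arctan_tail_1_eq P_def atLeast0AtMost lessThan_Suc_atMost)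
  have "arctan_tail (Suc (Suc (2 * h))) 1 = arctan_tail (Suc (2 * h)) 1 + 1 / (4 * x - 1)"
    using arctan_tail_Suc[of "Suc (2 * h)" 1] by (simp add: x_def algebra_simps)
  then have tail': "arctan_tail (Suc (Suc (2 * h))) 1 = pi / 4 - P + 1 / (4 * x - 1)"
    by (simp only: tail)
  have e: "real (2 * h) + 1 = 2 * x - 1" "real (Suc (2 * h)) + 1 = 2 * x"
    by (simp_all add: x_def)
  have step: "tail_sum (2 * Suc h) = tail_sum (2 * h)
      + (catalan_const / (2 * (2 * x - 1)) - pi / (16 * (2 * x - 1) ^ 2)) - (pi / 4 - P) / (4 * (2 * x - 1) ^ 2)
      - (catalan_const / (2 * (2 * x)) - pi / (16 * (2 * x) ^ 2))
      - (pi / 4 - P + 1 / (4 * x - 1)) / (4 * (2 * x) ^ 2)"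
    using tail_sum_Suc[of "2 * h"] tail_sum_Suc[of "Suc (2 * h)"]
    unfolding tail tail' e by simp
  have inner: "(\<Sum>j=0..2*Suc h-2. (-1) ^ j * (8 * x ^ 2 - 4 * x + 1)
           / (x ^ 2 * (2 * real j + 1) * (2 * x - 1) ^ 2))
       = P * ((8 * x ^ 2 - 4 * x + 1) / (x ^ 2 * (2 * x - 1) ^ 2))"
    unfolding P_def sum_distrib_right by (intro sum.cong) (simp_all add: mult_ac)
  have nz: "x \<noteq> 0" "2 * x - 1 \<noteq> 0" "4 * x - 1 \<noteq> 0" using x by auto
  have "- 4 * (tail_sum (2 * Suc h) - tail_sum (2 * h)) = 1 / 4 * (1 / (x ^ 2 * (4 * x - 1)))
     - 1 / 4 * (P * ((8 * x ^ 2 - 4 * x + 1) / (x ^ 2 * (2 * x - 1) ^ 2)))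
     + 1 / 2 * (1 / (2 * x - 1) ^ 2) * pi
     - catalan_const * (1 / (x * (2 * x - 1)))"
    unfolding step using nz by (simp add: divide_simps) algebra
  then show ?case using Suc.IH
    by (simp only: sum.nat_ivl_Suc' sum.cl_ivl_Suc x_def[symmetric] inner)
       (simp add: inner algebra_simps)
qed simp

text \<open>The same double step, now from 2h + 1 to 2h + 3, with 8x^2 + 4x + 1 = (2x)^2 + (2x +
  1)^2. Here \<open>P\<close> is the longer of the two partial sums, so the correction 1/(4x + 1)
  belongs to the first tail. The base case is one step from \<open>tail_sum 0\<close>, which
  supplies the constants 1, 2G and -pi/2.\<close>

lemma tail_sum_odd:
  "4 * tail_sum (2 * h + 1) = 4 * tail_sum 0 + 1
     - (\<Sum>j=1..h. 1 / (4 * real j ^ 2 * (4 * real j + 1)))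
     + 1 / 4 * (\<Sum>k=1..h. \<Sum>j=0..2*k. (-1) ^ j * (8 * real k ^ 2 + 4 * real k + 1)
           / (real k ^ 2 * (2 * real j + 1) * (2 * real k + 1) ^ 2))
     + (2 - (\<Sum>j=1..h. 1 / (real j * (2 * real j + 1)))) * catalan_const
     - (1 / 2 + 1 / 2 * (\<Sum>j=1..h. 1 / (2 * real j + 1) ^ 2)) * pi"
proof (induction h)
  case 0
  show ?case using tail_sum_Suc[of 0] by (simp add: arctan_tail_1_eq field_simps)
next
  case (Suc h)
  define x where "x = real (Suc h)"
  have x: "x \<ge> 1" by (simp add: x_def)
  define P where "P = (\<Sum>j=0..2*Suc h. (-1) ^ j / (2 * real j + 1) :: real)"
  have tail': "arctan_tail (Suc (Suc (Suc (2 * h)))) 1 = pi / 4 - P"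
    by (simp add: arctan_tail_1_eq P_def atLeast0AtMost flip: lessThan_Suc_atMost)
  have "arctan_tail (Suc (Suc (Suc (2 * h)))) 1 = arctan_tail (Suc (Suc (2 * h))) 1 - 1 / (4 * x + 1)"
    using arctan_tail_Suc[of "Suc (Suc (2 * h))" 1] by (simp add: x_def algebra_simps)
  then have tail: "arctan_tail (Suc (Suc (2 * h))) 1 = pi / 4 - P + 1 / (4 * x + 1)"
    by (simp only: tail')
  have e: "real (Suc (2 * h)) + 1 = 2 * x" "real (Suc (Suc (2 * h))) + 1 = 2 * x + 1"
    by (simp_all add: x_def)
  have step: "tail_sum (2 * Suc h + 1) = tail_sum (2 * h + 1)
      - (catalan_const / (2 * (2 * x)) - pi / (16 * (2 * x) ^ 2))
      - (pi / 4 - P + 1 / (4 * x + 1)) / (4 * (2 * x) ^ 2)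
      + (catalan_const / (2 * (2 * x + 1)) - pi / (16 * (2 * x + 1) ^ 2)) - (pi / 4 - P) / (4 * (2 * x + 1) ^ 2)"
    using tail_sum_Suc[of "Suc (2 * h)"] tail_sum_Suc[of "Suc (Suc (2 * h))"]
    unfolding tail tail' e by simp
  have inner: "(\<Sum>j=0..2*Suc h. (-1) ^ j * (8 * x ^ 2 + 4 * x + 1)
           / (x ^ 2 * (2 * real j + 1) * (2 * x + 1) ^ 2))
       = P * ((8 * x ^ 2 + 4 * x + 1) / (x ^ 2 * (2 * x + 1) ^ 2))"
    unfolding P_def sum_distrib_right by (intro sum.cong) (simp_all add: mult_ac)
  have nz: "x \<noteq> 0" "2 * x + 1 \<noteq> 0" "4 * x + 1 \<noteq> 0" using x by auto
  have "4 * (tail_sum (2 * Suc h + 1) - tail_sum (2 * h + 1)) = - (1 / (4 * x ^ 2 * (4 * x + 1)))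
     + 1 / 4 * (P * ((8 * x ^ 2 + 4 * x + 1) / (x ^ 2 * (2 * x + 1) ^ 2)))
     - 1 / (x * (2 * x + 1)) * catalan_const
     - 1 / 2 * (1 / (2 * x + 1) ^ 2) * pi"
    unfolding step using nz by (simp add: divide_simps) algebra
  then show ?case using Suc.IH
    by (simp only: sum.cl_ivl_Suc x_def[symmetric] inner)
       (simp add: inner algebra_simps)
qed

lemma sum_arctan_tail:
  "4 * (\<Sum>k=0..m. arctan_tail (k + 1 + d) 1 / (2 * real k + 1) ^ 2) =
     pi - 4 - 4 * (\<Sum>j=1..d. (-1) ^ j / (2 * real j + 1))
     + pi * (\<Sum>k=1..m. 1 / (2 * real k + 1) ^ 2)
     - 4 * (\<Sum>k=1..m. \<Sum>j=0..k+d. (-1) ^ j / ((2 * real j + 1) * (2 * real k + 1) ^ 2))"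
proof -
  have tail: "4 * (arctan_tail (k + 1 + d) 1 / (2 * real k + 1) ^ 2) =
     pi * (1 / (2 * real k + 1) ^ 2) - 4 * (\<Sum>j=0..k+d. (-1) ^ j / ((2 * real j + 1) * (2 * real k + 1) ^ 2))" for k
  proof -
    have "{..<k + 1 + d} = {0..k + d}" by auto
    then have "arctan_tail (k + 1 + d) 1 = pi / 4 - (\<Sum>j=0..k+d. (-1) ^ j / (2 * real j + 1))"
      by (simp only: arctan_tail_1_eq)
    moreover have "(\<Sum>j=0..k+d. (-1) ^ j / ((2 * real j + 1) * (2 * real k + 1) ^ 2)) =
        (\<Sum>j=0..k+d. (-1) ^ j / (2 * real j + 1)) / (2 * real k + 1) ^ 2"
      unfolding sum_divide_distrib by simp
    ultimately show ?thesis by (simp add: diff_divide_distrib)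
  qed
  \<comment> \<open>The term k = 0 has denominator 1 and is split off; it is the source of pi - 4
    and of the single sum over j from 1 to d.\<close>
  have "(\<Sum>j=0..0+d. (-1) ^ j / ((2 * real j + 1) * (2 * real 0 + 1) ^ 2)) =
      1 + (\<Sum>j=1..d. (-1) ^ j / (2 * real j + 1) :: real)"
    by (simp add: sum.atLeast_Suc_atMost)
  then show ?thesis
    unfolding sum_distrib_left[of 4] tail
    by (simp add: sum.atLeast_Suc_atMost sum_subtractf sum_distrib_left)
qed

subsection \<open>The dilogarithm on the slit plane\<close>

lemma slit_plane_iff: "z \<in> slit_plane \<longleftrightarrow> Im z \<noteq> 0 \<or> Re z < 1"
  by (auto simp: slit_plane_def image_iff complex_eq_iff not_le intro: exI[of _ "Re _"])

text \<open>Since z Li_3'(z) = Li_2(z), this inherits the continuation to the slit plane from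
  \<open>trilog\<close>, and no second choice of a continuation is needed.\<close>

definition dilog :: "complex \<Rightarrow> complex" where
  "dilog z = z * deriv trilog z"

lemma trilog_has_field_derivative:
  assumes "z \<in> slit_plane" "z \<noteq> 0"
  shows "(trilog has_field_derivative dilog z / z) (at z)"
  using holomorphic_derivI[OF trilog_holomorphic open_slit_plane assms(1)] assms(2)
  by (simp add: dilog_def)

lemma dilog_holomorphic: "dilog holomorphic_on slit_plane"
  unfolding dilog_def[abs_def]
  by (intro holomorphic_intros holomorphic_deriv trilog_holomorphic open_slit_plane)

lemma isCont_dilog: "z \<in> slit_plane \<Longrightarrow> isCont dilog z"
  using holomorphic_on_imp_continuous_on[OF dilog_holomorphic] open_slit_plane
  by (simp add: continuous_on_eq_continuous_at)

lemma dilog_eq_series_ball: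
  assumes "norm z < 1"
  shows "dilog z = polylog_series 2 z"
proof -
  have "(polylog_series (Suc 2) has_field_derivative (\<Sum>k. (1 / of_nat (Suc k) ^ 2) * z ^ k)) (at z)"
    by (rule polylog_series_deriv[OF assms])
  then have "(trilog has_field_derivative (\<Sum>k. (1 / of_nat (Suc k) ^ 2) * z ^ k)) (at z)"
    by (rule has_field_derivative_transform_within_open[of _ _ _ "ball 0 1"])
       (use assms trilog_series in \<open>auto simp: numeral_3_eq_3 numeral_2_eq_2\<close>)
  then show ?thesis
    using polylog_series_eq[OF assms, of 2] by (simp add: dilog_def DERIV_imp_deriv)
qed

lemma polylog_series_radial_limit:
  assumes "norm z \<le> 1" "s \<ge> 2"
  shows "((\<lambda>r. polylog_series s (of_real r * z)) \<longlongrightarrow> polylog_series s z) (at_left (1::real))"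
proof -
  have "((\<lambda>r. of_real r * z) \<longlongrightarrow> of_real 1 * z) (at_left (1::real))"
    by (intro tendsto_intros)
  then have lim: "((\<lambda>r. of_real r * z) \<longlongrightarrow> z) (at_left (1::real))" by simp
  have "\<forall>\<^sub>F r in at_left (1::real). r \<in> {0<..<1}"
    by (rule eventually_at_left_real) simp
  then have "\<forall>\<^sub>F r in at_left (1::real). of_real r * z \<in> cball 0 1"
    by eventually_elim (use assms in \<open>auto simp: norm_mult mult_le_one\<close>)
  then show ?thesis
    using continuous_on_tendsto_compose[OF continuous_on_polylog_series[OF assms(2)] lim] assms(1)
    by simp
qed

text \<open>Abel-type limits reach the whole unit circle, including the branch point 1, where
  \<open>dilog\<close> is not known to be continuous.\<close>

lemma dilog_radial_limit:
  assumes "norm z \<le> 1"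
  shows "((\<lambda>r. dilog (of_real r * z)) \<longlongrightarrow> polylog_series 2 z) (at_left (1::real))"
proof -
  have "\<forall>\<^sub>F r in at_left (1::real). r \<in> {0<..<1}"
    by (rule eventually_at_left_real) simp
  then have "\<forall>\<^sub>F r in at_left (1::real). polylog_series 2 (of_real r * z) = dilog (of_real r * z)"
  proof eventually_elim
    case (elim r)
    then have "norm (of_real r * z) \<le> r * 1"
      using assms by (simp add: norm_mult mult_left_le)
    with elim have "norm (of_real r * z) < 1" by simp
    then show ?case by (simp add: dilog_eq_series_ball)
  qed
  then show ?thesis
    using polylog_series_radial_limit[OF assms, of 2] by (blast intro: Lim_transform_eventually)
qed

lemma dilog_eq_series:
  assumes "norm z \<le> 1" "z \<in> slit_plane"
  shows "dilog z = polylog_series 2 z"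
proof -
  have "((\<lambda>r. of_real r * z) \<longlongrightarrow> of_real 1 * z) (at_left (1::real))"
    by (intro tendsto_intros)
  then have "((\<lambda>r. dilog (of_real r * z)) \<longlongrightarrow> dilog z) (at_left (1::real))"
    by (intro isCont_tendsto_compose[OF isCont_dilog[OF assms(2)]]) simp
  with dilog_radial_limit[OF assms(1)] show ?thesis
    using tendsto_unique trivial_limit_at_left_real by blast
qed

lemma polylog_series_1:
  assumes "norm z < 1"
  shows "polylog_series 1 z = - Ln (1 - z)"
proof -
  have "(\<lambda>n. - (z ^ n) / of_nat n) sums Ln (1 - z)"
    using Ln_series'[of "- z"] assms by simp
  then have "(\<lambda>n. - (z ^ Suc n) / of_nat (Suc n)) sums Ln (1 - z)"
    by (subst sums_Suc_iff) simp
  then have "(\<lambda>n. - (- (z ^ Suc n) / of_nat (Suc n))) sums - Ln (1 - z)"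
    by (rule sums_minus)
  then show ?thesis
    by (simp add: polylog_series_def sums_iff del: of_nat_Suc power_Suc)
qed

lemma slit_plane_imp_1_minus: "z \<in> slit_plane \<Longrightarrow> 1 - z \<notin> \<real>\<^sub>\<le>\<^sub>0"
  by (auto simp: slit_plane_iff complex_nonpos_Reals_iff)

text \<open>In the unit disc termwise differentiation gives z Li_2'(z) = Li_1(z) = -Ln(1 - z), and
  the identity theorem extends this to the slit plane. Keeping the factor z makes both sides
  holomorphic at 0 as well.\<close>

lemma dilog_has_field_derivative:
  assumes "z \<in> slit_plane" "z \<noteq> 0"
  shows "(dilog has_field_derivative - Ln (1 - z) / z) (at z)"
proof -
  have "z * deriv dilog z = - Ln (1 - z)"
  proof (rule analytic_continuation_open[of "ball 0 1" slit_plane "\<lambda>z. z * deriv dilog z" "\<lambda>z. - Ln (1 - z)"])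
    show "connected slit_plane"
      using starlike_imp_connected[OF starlike_slit_plane] .
    show "(\<lambda>z. z * deriv dilog z) holomorphic_on slit_plane"
      by (intro holomorphic_intros holomorphic_deriv dilog_holomorphic open_slit_plane)
    show "(\<lambda>z. - Ln (1 - z)) holomorphic_on slit_plane"
      by (intro holomorphic_intros) (auto dest: slit_plane_imp_1_minus)
    fix w :: complex assume w: "w \<in> ball 0 1"
    have "(polylog_series (Suc 1) has_field_derivative (\<Sum>k. (1 / of_nat (Suc k) ^ 1) * w ^ k)) (at w)"
      using w by (intro polylog_series_deriv) auto
    then have "(dilog has_field_derivative (\<Sum>k. (1 / of_nat (Suc k) ^ 1) * w ^ k)) (at w)"
      by (rule has_field_derivative_transform_within_open[of _ _ _ "ball 0 1"])
         (use w dilog_eq_series_ball in \<open>auto simp: numeral_2_eq_2\<close>)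
    then show "w * deriv dilog w = - Ln (1 - w)"
      using polylog_series_eq[of w 1] polylog_series_1[of w] w by (simp add: DERIV_imp_deriv)
  qed (use assms open_slit_plane ball_subset_slit_plane in auto)
  then have "deriv dilog z = - Ln (1 - z) / z" using assms(2) by (simp add: field_simps)
  then show ?thesis
    using holomorphic_derivI[OF dilog_holomorphic open_slit_plane assms(1)] by simp
qed

section \<open>The reflection formula on the doubly slit plane\<close>

definition double_slit_plane :: "complex set" where
  "double_slit_plane = {z. Im z \<noteq> 0 \<or> (0 < Re z \<and> Re z < 1)}"

lemma open_double_slit_plane: "open double_slit_plane"
  unfolding double_slit_plane_def
  by (intro open_Collect_disj open_Collect_conj open_Collect_neq open_Collect_less continuous_intros)

lemma double_slit_planeD:
  assumes "z \<in> double_slit_plane"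
  shows "z \<in> slit_plane" "1 - z \<in> slit_plane" "z \<notin> \<real>\<^sub>\<le>\<^sub>0" "1 - z \<notin> \<real>\<^sub>\<le>\<^sub>0" "z \<noteq> 0" "z \<noteq> 1"
  using assms by (auto simp: double_slit_plane_def slit_plane_iff complex_nonpos_Reals_iff)

lemma of_real_in_double_slit_plane: "0 < r \<Longrightarrow> r < 1 \<Longrightarrow> of_real r \<in> double_slit_plane"
  by (simp add: double_slit_plane_def)

text \<open>The point 1/2 lies in the gap between the two cuts, and the doubly slit plane is
  star-shaped about it; this survives intersection with a convex set containing 1/2. The cases
  needed are the whole plane and the unit disc about 1.\<close>

lemma connected_double_slit_plane_Int:
  assumes "convex T" "1 / 2 \<in> T"
  shows "connected (double_slit_plane \<inter> T)"
proof (rule starlike_imp_connected)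
  show "starlike (double_slit_plane \<inter> T)"
    unfolding starlike_def
  proof (intro bexI[of _ "1 / 2"] ballI subsetI)
    fix z w assume z: "z \<in> double_slit_plane \<inter> T" and w: "w \<in> closed_segment (1 / 2) z"
    from w obtain u where u: "0 \<le> u" "u \<le> 1" "w = (1 - u) *\<^sub>R (1 / 2) + u *\<^sub>R z"
      by (auto simp: in_segment)
    have "w \<in> double_slit_plane"
    proof (cases "u = 0 \<or> Im z \<noteq> 0")
      case True
      then show ?thesis using u(3) by (auto simp: double_slit_plane_def)
    next
      case False
      with z u have *: "0 < u" "0 < Re z" "Re z < 1" "Im z = 0"
        by (auto simp: double_slit_plane_def)
      have "u * Re z < u" "0 < u * Re z" using * by auto
      moreover have "Re w = (1 - u) / 2 + u * Re z" by (simp add: u(3))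
      ultimately have "0 < Re w \<and> Re w < 1" using u(1,2) by (simp add: field_simps)
      then show ?thesis by (simp add: double_slit_plane_def)
    qed
    moreover have "w \<in> T"
      using w z assms closed_segment_subset[of "1 / 2" T z] by auto
    ultimately show "w \<in> double_slit_plane \<inter> T" by simp
  qed (use assms in \<open>auto simp: double_slit_plane_def\<close>)
qed

lemma dilog_at_left_1:
  "((\<lambda>r. dilog (of_real r)) \<longlongrightarrow> of_real (pi ^ 2 / 6)) (at_left (1::real))"
proof -
  have "(\<lambda>n. complex_of_real (1 / (real n + 1) ^ 2)) sums of_real (pi ^ 2 / 6)"
    using inverse_squares_sums by (subst sums_of_real_iff) (simp add: add_ac)
  then have "polylog_series 2 1 = of_real (pi ^ 2 / 6)"
    by (simp add: polylog_series_def sums_iff add_ac)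
  then show ?thesis
    using dilog_radial_limit[of 1] by (simp only: mult_1_right) (simp del: of_real_divide of_real_power)
qed

text \<open>The derivatives cancel, so the left side is constant on a connected set. Letting a real
  argument r tend to 1 from below identifies the constant: the first term tends to pi^2/6,
  \<open>dilog (1 - r)\<close> tends to \<open>dilog 0\<close> = 0, and ln r ln(1 - r) tends to
  0.\<close>

lemma dilog_reflection:
  assumes "z \<in> double_slit_plane"
  shows "dilog z + dilog (1 - z) + Ln z * Ln (1 - z) = of_real (pi ^ 2 / 6)"
proof -
  let ?f = "\<lambda>z. dilog z + dilog (1 - z) + Ln z * Ln (1 - z)"
  have "(?f has_field_derivative 0) (at z)" if z: "z \<in> double_slit_plane" for z
  proof -
    note * = double_slit_planeD[OF z]
    have nz: "1 - z \<noteq> 0" using *(6) by simp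
    have "((\<lambda>z. 1 - z) has_field_derivative - 1) (at z)"
      by (auto intro!: derivative_eq_intros)
    then have "((\<lambda>z. dilog (1 - z)) has_field_derivative (- Ln (1 - (1 - z)) / (1 - z)) * - 1) (at z)"
      by (rule DERIV_chain'[OF _ dilog_has_field_derivative]) (use * nz in auto)
    moreover have "((\<lambda>z. Ln (1 - z)) has_field_derivative inverse (1 - z) * - 1) (at z)"
      by (rule DERIV_chain'[OF \<open>((\<lambda>z. 1 - z) has_field_derivative - 1) (at z)\<close> has_field_derivative_Ln])
         (use * in auto)
    ultimately have "(?f has_field_derivative - Ln (1 - z) / z + (- Ln (1 - (1 - z)) / (1 - z)) * - 1 +
        (inverse z * Ln (1 - z) + inverse (1 - z) * - 1 * Ln z)) (at z)"
      by (intro DERIV_add DERIV_mult dilog_has_field_derivative has_field_derivative_Ln) (use * in auto)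
    then show ?thesis by (simp add: divide_inverse mult.commute)
  qed
  note der = this
  obtain c where c: "\<And>z. z \<in> double_slit_plane \<Longrightarrow> ?f z = c"
  proof (rule DERIV_zero_connected_constant[of double_slit_plane "{}" ?f])
    show "connected double_slit_plane"
      using connected_double_slit_plane_Int[of UNIV] by simp
    show "continuous_on double_slit_plane ?f"
      by (intro continuous_at_imp_continuous_on ballI DERIV_isCont) (rule der)
  qed (use der open_double_slit_plane in auto)
  have ev: "\<forall>\<^sub>F r in at_left (1::real). r \<in> {0<..<1}"
    by (rule eventually_at_left_real) simp
  have "((\<lambda>r. complex_of_real 1 - of_real r) \<longlongrightarrow> of_real 1 - of_real 1) (at_left (1::real))"
    by (intro tendsto_intros)
  then have "((\<lambda>r. dilog (1 - of_real r)) \<longlongrightarrow> dilog 0) (at_left (1::real))"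
    by (intro isCont_tendsto_compose[OF isCont_dilog]) (auto simp: slit_plane_iff)
  moreover have "((\<lambda>r::real. ln r * ln (1 - r)) \<longlongrightarrow> 0) (at_left 1)"
    by real_asymp
  then have "((\<lambda>r::real. complex_of_real (ln r * ln (1 - r))) \<longlongrightarrow> of_real 0) (at_left 1)"
    by (rule tendsto_of_real)
  ultimately have "((\<lambda>r. dilog (of_real r) + dilog (1 - of_real r) + of_real (ln r * ln (1 - r)))
      \<longlongrightarrow> of_real (pi ^ 2 / 6) + dilog 0 + of_real 0) (at_left (1::real))"
    by (intro tendsto_add dilog_at_left_1)
  moreover have "\<forall>\<^sub>F r in at_left (1::real). dilog (of_real r) + dilog (1 - of_real r) + of_real (ln r * ln (1 - r)) = c"
    using ev
  proof eventually_elim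
    case (elim r)
    have "Ln (1 - of_real r) = of_real (ln (1 - r))"
      using elim Ln_of_real[of "1 - r"] by simp
    then show ?case
      using c[OF of_real_in_double_slit_plane, of r] elim by (simp add: Ln_of_real)
  qed
  ultimately have "((\<lambda>r. c) \<longlongrightarrow> of_real (pi ^ 2 / 6) + dilog 0 + of_real 0) (at_left (1::real))"
    by (rule Lim_transform_eventually)
  then have "c = of_real (pi ^ 2 / 6)"
    by (simp add: tendsto_const_iff dilog_def)
  with c[OF assms] show ?thesis by simp
qed

section \<open>A primitive of the squared logarithm and its limit at 1\<close>

definition log_square_primitive :: "complex \<Rightarrow> complex" where
  "log_square_primitive z = Ln (1 - z) * Ln z ^ 2 + 2 * Ln z * dilog z - 2 * trilog z"

text \<open>The product rule yields the terms 2 Ln z Ln(1 - z)/z and 2 Li_2(z)/z twice each, with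
  opposite signs; only the derivative of Ln(1 - z) leaves a contribution.\<close>

lemma log_square_primitive_has_field_derivative:
  assumes "z \<in> double_slit_plane"
  shows "(log_square_primitive has_field_derivative - (Ln z ^ 2 / (1 - z))) (at z)"
proof -
  note * = double_slit_planeD[OF assms]
  have nz: "1 - z \<noteq> 0" using *(6) by simp
  have "((\<lambda>z. 1 - z) has_field_derivative - 1) (at z)"
    by (auto intro!: derivative_eq_intros)
  then have "((\<lambda>z. Ln (1 - z)) has_field_derivative inverse (1 - z) * - 1) (at z)"
    by (rule DERIV_chain'[OF _ has_field_derivative_Ln]) (use * in auto)
  note d1 = this
  have d2: "((\<lambda>z. Ln z ^ 2) has_field_derivative of_nat 2 * (inverse z * Ln z ^ (2 - Suc 0))) (at z)"
    by (intro DERIV_power has_field_derivative_Ln *)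
  have d3: "((\<lambda>z. 2 * Ln z) has_field_derivative 2 * inverse z) (at z)"
    by (intro DERIV_cmult has_field_derivative_Ln *)
  have "(log_square_primitive has_field_derivative
      (inverse (1 - z) * - 1 * Ln z ^ 2 + of_nat 2 * (inverse z * Ln z ^ (2 - Suc 0)) * Ln (1 - z))
      + (2 * inverse z * dilog z + (- Ln (1 - z) / z) * (2 * Ln z)) - 2 * (dilog z / z)) (at z)"
    unfolding log_square_primitive_def[abs_def]
    by (rule DERIV_diff[OF DERIV_add[OF DERIV_mult[OF d1 d2]
        DERIV_mult[OF d3 dilog_has_field_derivative[OF *(1,5)]]]
        DERIV_cmult[OF trilog_has_field_derivative[OF *(1,5)]]])
  then show ?thesis by (simp add: divide_inverse mult_ac)
qed

lemma log_square_primitive_at_left_1: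
  "((\<lambda>r. log_square_primitive (of_real r)) \<longlongrightarrow> - 2 * polylog_series 3 1) (at_left (1::real))"
proof -
  have ev: "\<forall>\<^sub>F r in at_left (1::real). r \<in> {0<..<1}"
    by (rule eventually_at_left_real) simp
  have t1: "((\<lambda>r. trilog (of_real r)) \<longlongrightarrow> polylog_series 3 1) (at_left (1::real))"
  proof (rule Lim_transform_eventually)
    show "((\<lambda>r. polylog_series 3 (of_real r * 1)) \<longlongrightarrow> polylog_series 3 1) (at_left (1::real))"
      by (rule polylog_series_radial_limit) auto
    show "\<forall>\<^sub>F r in at_left (1::real). polylog_series 3 (of_real r * 1) = trilog (of_real r)"
      using ev by eventually_elim (simp add: trilog_series)
  qed
  have "((\<lambda>r::real. ln (1 - r) * ln r ^ 2) \<longlongrightarrow> 0) (at_left 1)"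
    by real_asymp
  then have t2: "((\<lambda>r::real. complex_of_real (ln (1 - r) * ln r ^ 2)) \<longlongrightarrow> of_real 0) (at_left 1)"
    by (rule tendsto_of_real)
  have "((\<lambda>r::real. 2 * ln r) \<longlongrightarrow> 0) (at_left 1)"
    by real_asymp
  then have t3: "((\<lambda>r::real. complex_of_real (2 * ln r)) \<longlongrightarrow> of_real 0) (at_left 1)"
    by (rule tendsto_of_real)
  have "((\<lambda>r. of_real (ln (1 - r) * ln r ^ 2) + of_real (2 * ln r) * dilog (of_real r)
       - 2 * trilog (of_real r)) \<longlongrightarrow> of_real 0 + of_real 0 * of_real (pi ^ 2 / 6) - 2 * polylog_series 3 1)
       (at_left (1::real))"
    by (intro tendsto_diff tendsto_add tendsto_mult tendsto_const t1 t2 t3 dilog_at_left_1)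
  moreover have "\<forall>\<^sub>F r in at_left (1::real). of_real (ln (1 - r) * ln r ^ 2) + of_real (2 * ln r) * dilog (of_real r)
       - 2 * trilog (of_real r) = log_square_primitive (of_real r)"
    using ev
  proof eventually_elim
    case (elim r)
    have "Ln (1 - of_real r) = of_real (ln (1 - r))"
      using elim Ln_of_real[of "1 - r"] by simp
    then show ?case using elim by (simp add: log_square_primitive_def Ln_of_real)
  qed
  ultimately show ?thesis by (auto dest: Lim_transform_eventually)
qed

text \<open>The numerator has a double zero at 1, so the singularity is removable and a primitive
  exists on the full disc, across the cut of \<open>log_square_primitive\<close>. It serves to
  compare different directions of approach to 1.\<close>

lemma Ln_squared_primitive:
  "\<exists>J. \<forall>z\<in>ball 1 1. (J has_field_derivative (if z = 1 then 0 else Ln z ^ 2 / (1 - z))) (at z)"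
proof (rule holomorphic_starlike_primitive[where k = "{1}"])
  let ?g = "\<lambda>z. if z = 1 then 0 else Ln z ^ 2 / (1 - z)"
  have nonpos: "z \<notin> \<real>\<^sub>\<le>\<^sub>0" if "z \<in> ball 1 1" for z :: complex
  proof
    assume "z \<in> \<real>\<^sub>\<le>\<^sub>0"
    then have "Re z \<le> 0" by (simp add: complex_nonpos_Reals_iff)
    then have "1 \<le> \<bar>Re (1 - z)\<bar>" by simp
    also have "\<dots> \<le> norm (1 - z)" by (rule abs_Re_le_cmod)
    finally show False using that by (simp add: dist_norm)
  qed
  show diff: "?g field_differentiable at z" if "z \<in> ball 1 1 - {1}" for z
  proof -
    have "(\<lambda>z. Ln z ^ 2 / (1 - z)) field_differentiable at z"
      using that nonpos[of z]
      by (intro derivative_intros field_differentiable_at_Ln) auto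
    then obtain D where D: "((\<lambda>z. Ln z ^ 2 / (1 - z)) has_field_derivative D) (at z)"
      unfolding field_differentiable_def by blast
    have "(?g has_field_derivative D) (at z)"
      by (rule has_field_derivative_transform_within_open[OF D, of "- {1}"]) (use that in auto)
    then show ?thesis unfolding field_differentiable_def by blast
  qed
  \<comment> \<open>The quotient is Ln z times the negated difference quotient of Ln at 1; the first
    factor tends to 0 and the second to -1.\<close>
  have "(\<lambda>z. Ln z * (- ((Ln z - Ln 1) / (z - 1)))) \<midarrow>1\<rightarrow> Ln 1 * (- (inverse 1))"
  proof (intro tendsto_mult tendsto_minus)
    have "(Ln has_field_derivative inverse 1) (at 1)"
      by (rule has_field_derivative_Ln) auto
    then show "(\<lambda>z. (Ln z - Ln 1) / (z - 1)) \<midarrow>1\<rightarrow> inverse 1"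
      by (simp add: has_field_derivative_iff)
    have "isCont Ln (1::complex)" by (rule continuous_at_Ln) auto
    then show "Ln \<midarrow>1\<rightarrow> Ln (1::complex)" by (simp add: isCont_def)
  qed
  moreover have "Ln 1 * (- (inverse 1)) = (0 :: complex)" by simp
  ultimately have "(\<lambda>z. Ln z * (- ((Ln z - Ln 1) / (z - 1)))) \<midarrow>1\<rightarrow> 0" by (simp only:)
  then have "?g \<midarrow>1\<rightarrow> 0"
  proof (rule Lim_transform_eventually)
    have "\<forall>\<^sub>F z in at 1. z \<noteq> (1::complex)" by (simp add: eventually_at_filter)
    then show "\<forall>\<^sub>F z in at 1. Ln z * (- ((Ln z - Ln 1) / (z - 1))) = ?g z"
    proof eventually_elim
      case (elim z)
      have "- ((Ln z - Ln 1) / (z - 1)) = Ln z / (1 - z)"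
        by (metis Ln_1 diff_zero minus_diff_eq minus_divide_right)
      then show ?case using elim by (simp add: power2_eq_square)
    qed
  qed
  then have "isCont ?g 1" by (simp add: isCont_def)
  moreover have "isCont ?g z" if "z \<in> ball 1 1 - {1}" for z
    using diff[OF that] by (rule field_differentiable_imp_continuous_at)
  ultimately show "continuous_on (ball 1 1) ?g"
    by (intro continuous_at_imp_continuous_on) blast
qed (auto intro: convex_imp_starlike)

text \<open>The integration path leaves the branch point 1 vertically, while the limit is easy to
  compute along the real segment. Near 1 the sum of \<open>log_square_primitive\<close> and
  \<open>J\<close> is constant off the cuts, and \<open>J\<close> is continuous at 1, so both
  approaches give the same limit.\<close>

lemma log_square_primitive_vertical_limit:
  "((\<lambda>x. log_square_primitive (1 + \<i> * of_real x)) \<longlongrightarrow> - 2 * polylog_series 3 1) (at_right (0::real))"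
proof -
  obtain J where J: "\<And>z. z \<in> ball 1 1 \<Longrightarrow>
      (J has_field_derivative (if z = 1 then 0 else Ln z ^ 2 / (1 - z))) (at z)"
    using Ln_squared_primitive by blast
  let ?V = "double_slit_plane \<inter> ball 1 1"
  have der: "((\<lambda>z. log_square_primitive z + J z) has_field_derivative 0) (at z)" if "z \<in> ?V" for z
  proof -
    have "(log_square_primitive has_field_derivative - (Ln z ^ 2 / (1 - z))) (at z)"
      by (rule log_square_primitive_has_field_derivative) (use that in auto)
    moreover have "(J has_field_derivative Ln z ^ 2 / (1 - z)) (at z)"
      using J[of z] that double_slit_planeD(6)[of z] by auto
    ultimately show ?thesis using DERIV_add by fastforce
  qed
  obtain c where c: "\<And>z. z \<in> ?V \<Longrightarrow> log_square_primitive z + J z = c"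
  proof (rule DERIV_zero_connected_constant[of ?V "{}" "\<lambda>z. log_square_primitive z + J z"])
    show "connected ?V"
      by (rule connected_double_slit_plane_Int) (auto simp: dist_norm)
    show "continuous_on ?V (\<lambda>z. log_square_primitive z + J z)"
      by (intro continuous_at_imp_continuous_on ballI DERIV_isCont) (rule der)
  qed (use der open_double_slit_plane in \<open>auto intro: open_Int\<close>)
  have J1: "isCont J 1"
    using J[of 1] by (intro DERIV_isCont) auto
  have lim: "((\<lambda>x. log_square_primitive (f x)) \<longlongrightarrow> c - J 1) F"
    if "(f \<longlongrightarrow> 1) F" "\<forall>\<^sub>F x in F. f x \<in> ?V" for f and F :: "real filter"
  proof (rule Lim_transform_eventually)
    show "((\<lambda>x. c - J (f x)) \<longlongrightarrow> c - J 1) F"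
      by (intro tendsto_intros isCont_tendsto_compose[OF J1] that)
    show "\<forall>\<^sub>F x in F. c - J (f x) = log_square_primitive (f x)"
      using that(2) by eventually_elim (use c in \<open>force simp: algebra_simps\<close>)
  qed
  have "((\<lambda>r. log_square_primitive (of_real r)) \<longlongrightarrow> c - J 1) (at_left (1::real))"
  proof (rule lim)
    show "(of_real \<longlongrightarrow> (1::complex)) (at_left (1::real))"
      by (intro tendsto_eq_intros) auto
    have "\<forall>\<^sub>F r in at_left (1::real). r \<in> {0<..<1}"
      by (rule eventually_at_left_real) simp
    then show "\<forall>\<^sub>F r in at_left (1::real). of_real r \<in> ?V"
    proof eventually_elim
      case (elim r)
      have "norm (complex_of_real (1 - r)) = 1 - r" using elim by (simp only: norm_of_real) simp
      then show ?case using elim by (simp add: of_real_in_double_slit_plane dist_norm)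
    qed
  qed
  then have "c - J 1 = - 2 * polylog_series 3 1"
    using log_square_primitive_at_left_1 by (rule tendsto_unique[rotated]) simp
  moreover have "((\<lambda>x. log_square_primitive (1 + \<i> * of_real x)) \<longlongrightarrow> c - J 1) (at_right (0::real))"
  proof (rule lim)
    show "((\<lambda>x. 1 + \<i> * of_real x) \<longlongrightarrow> (1::complex)) (at_right (0::real))"
      by (intro tendsto_eq_intros) auto
    have "\<forall>\<^sub>F x in at_right (0::real). x \<in> {0<..<1}"
      by (rule eventually_at_right_real) simp
    then show "\<forall>\<^sub>F x in at_right (0::real). 1 + \<i> * of_real x \<in> ?V"
      by eventually_elim (auto simp: double_slit_plane_def dist_norm norm_mult)
  qed
  ultimately show ?thesis by simp
qed

section \<open>Dilogarithm values on the imaginary axis and the value at 1 + i\<close>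

lemma polylog_series_2_sums:
  assumes "norm z \<le> 1"
  shows "(\<lambda>k. z ^ Suc k / of_nat (Suc k) ^ 2) sums polylog_series 2 z"
  unfolding polylog_series_def
proof (rule summable_sums, rule summable_comparison_test')
  show "summable (\<lambda>k. inverse (real (Suc k) ^ 2))"
    using inverse_power_summable[of 2, where 'a = real]
    by (subst summable_Suc_iff) auto
  fix k :: nat
  have "norm z ^ Suc k / real (Suc k) ^ 2 \<le> 1 / real (Suc k) ^ 2"
    using assms by (intro divide_right_mono power_le_one) auto
  then show "norm (z ^ Suc k / of_nat (Suc k) ^ 2) \<le> inverse (real (Suc k) ^ 2)"
    by (simp add: norm_divide norm_power norm_mult inverse_eq_divide del: of_nat_Suc)
qed

lemma ii_times_in_slit_plane: "\<i> * of_real x \<in> slit_plane"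
  by (auto simp: slit_plane_iff)

lemma Im_dilog_ii_sums:
  assumes "\<bar>x\<bar> \<le> 1"
  shows "(\<lambda>k. (-1) ^ k * x ^ (2 * k + 1) / (2 * real k + 1) ^ 2) sums Im (dilog (\<i> * of_real x))"
proof -
  let ?f = "\<lambda>k. Im ((\<i> * of_real x) ^ Suc k / of_nat (Suc k) ^ 2)"
  have expand: "?f n = Im (\<i> ^ Suc n) * x ^ Suc n / real (Suc n) ^ 2" for n
  proof -
    have "(\<i> * of_real x) ^ Suc n / of_nat (Suc n) ^ 2 =
        \<i> ^ Suc n * of_real (x ^ Suc n / real (Suc n) ^ 2)"
      by (simp add: power_mult_distrib del: power_Suc of_nat_Suc)
    moreover have "Im (w * of_real r) = Im w * r" for w r by simp
    ultimately show ?thesis by (simp only: times_divide_eq_right)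
  qed
  have "?f sums Im (polylog_series 2 (\<i> * of_real x))"
    by (rule sums_Im, rule polylog_series_2_sums) (use assms in \<open>simp add: norm_mult\<close>)
  also have "polylog_series 2 (\<i> * of_real x) = dilog (\<i> * of_real x)"
    using assms ii_times_in_slit_plane by (intro dilog_eq_series[symmetric]) (auto simp: norm_mult)
  \<comment> \<open>Index n carries the exponent n + 1, so the odd powers of i, the only non-real
    ones, sit at even n.\<close>
  also have "?f sums Im (dilog (\<i> * of_real x)) \<longleftrightarrow> (\<lambda>k. ?f (2 * k)) sums Im (dilog (\<i> * of_real x))"
  proof (rule sums_mono_reindex[symmetric])
    show "strict_mono (\<lambda>k::nat. 2 * k)" by (auto simp: strict_mono_def)
    fix n :: nat assume "n \<notin> range (\<lambda>k. 2 * k)"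
    then have "odd n" by (intro notI) (auto elim!: evenE)
    then obtain j where "n = 2 * j + 1" by (auto elim!: oddE)
    then have "\<i> ^ Suc n = of_real ((-1) ^ Suc j)" by (simp add: power_mult)
    then show "?f n = 0" unfolding expand by (simp only: Im_complex_of_real mult_zero_left div_0)
  qed
  also have "(\<lambda>k. ?f (2 * k)) = (\<lambda>k. (-1) ^ k * x ^ (2 * k + 1) / (2 * real k + 1) ^ 2)"
  proof
    fix k
    have "\<i> ^ Suc (2 * k) = \<i> * of_real ((-1) ^ k)" by (simp add: power_mult)
    then have "Im (\<i> ^ Suc (2 * k)) = (-1) ^ k" by (simp only: Im_i_times Re_complex_of_real)
    moreover have "real (Suc (2 * k)) = 2 * real k + 1" "Suc (2 * k) = 2 * k + 1" by simp_all
    ultimately show "?f (2 * k) = (-1) ^ k * x ^ (2 * k + 1) / (2 * real k + 1) ^ 2"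
      unfolding expand by (simp only:)
  qed
  finally show ?thesis .
qed

text \<open>Subtract twice the terms with even denominator from the full series: pi^2/6 - 2 (1/4)
  pi^2/6 = pi^2/12.\<close>

lemma alternating_squares_sums: "(\<lambda>k. (-1) ^ k / (real k + 1) ^ 2) sums (pi ^ 2 / 12)"
proof -
  let ?f = "\<lambda>k. (1 - (-1) ^ k) / (real k + 1) ^ 2"
  have sq: "(\<lambda>k. 1 / (real k + 1) ^ 2) sums (pi ^ 2 / 6)"
    using inverse_squares_sums by (simp add: add_ac)
  have "(\<lambda>k. ?f (2 * k + 1)) = (\<lambda>k. 1 / 2 * (1 / (real k + 1) ^ 2))"
  proof
    fix k
    have "real (2 * k + 1) + 1 = 2 * (real k + 1)" by simp
    then show "?f (2 * k + 1) = 1 / 2 * (1 / (real k + 1) ^ 2)"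
      by (simp only: power_mult_distrib) simp
  qed
  then have "(\<lambda>k. ?f (2 * k + 1)) sums (1 / 2 * (pi ^ 2 / 6))"
    using sums_mult[OF sq, of "1 / 2"] by simp
  moreover have "(\<lambda>k. ?f (2 * k + 1)) sums (1 / 2 * (pi ^ 2 / 6)) \<longleftrightarrow> ?f sums (1 / 2 * (pi ^ 2 / 6))"
  proof (rule sums_mono_reindex)
    show "strict_mono (\<lambda>k::nat. 2 * k + 1)" by (auto simp: strict_mono_def)
    fix n :: nat assume "n \<notin> range (\<lambda>k. 2 * k + 1)"
    then have "even n" by (intro ccontr[of "even n"]) (auto elim!: oddE)
    then show "?f n = 0" by simp
  qed
  ultimately have "?f sums (1 / 2 * (pi ^ 2 / 6))" by blast
  from sums_diff[OF sq this] show ?thesis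
    by (simp add: diff_divide_distrib)
qed

text \<open>Only even powers of -i are real, and their denominators are 4(k + 1)^2, which leaves
  -1/4 times the alternating sum pi^2/12.\<close>

lemma Re_dilog_minus_ii: "Re (dilog (- \<i>)) = - (pi ^ 2 / 48)"
proof -
  let ?f = "\<lambda>k. Re ((- \<i>) ^ Suc k / of_nat (Suc k) ^ 2)"
  have expand: "?f n = Re ((- \<i>) ^ Suc n) / real (Suc n) ^ 2" for n
  proof -
    have "(- \<i>) ^ Suc n / of_nat (Suc n) ^ 2 = (- \<i>) ^ Suc n / of_real (real (Suc n) ^ 2)"
      by simp
    then show ?thesis by (simp only: Re_divide_of_real)
  qed
  have "?f sums Re (polylog_series 2 (- \<i>))"
    by (rule sums_Re, rule polylog_series_2_sums) simp
  also have "polylog_series 2 (- \<i>) = dilog (- \<i>)"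
    by (intro dilog_eq_series[symmetric]) (auto simp: slit_plane_iff)
  also have "?f sums Re (dilog (- \<i>)) \<longleftrightarrow> (\<lambda>k. ?f (2 * k + 1)) sums Re (dilog (- \<i>))"
  proof (rule sums_mono_reindex[symmetric])
    show "strict_mono (\<lambda>k::nat. 2 * k + 1)" by (auto simp: strict_mono_def)
    fix n :: nat assume "n \<notin> range (\<lambda>k. 2 * k + 1)"
    then have "even n" by (intro ccontr[of "even n"]) (auto elim!: oddE)
    then obtain j where "n = 2 * j" by (auto elim!: evenE)
    then have "(- \<i>) ^ Suc n = - (\<i> * of_real ((-1) ^ j))" by (simp add: power_mult)
    then have "Re ((- \<i>) ^ Suc n) = 0" by (simp only: uminus_complex.sel Re_i_times Im_complex_of_real)
    then show "?f n = 0" unfolding expand by simp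
  qed
  also have "(\<lambda>k. ?f (2 * k + 1)) = (\<lambda>k. - (1 / 4) * ((-1) ^ k / (real k + 1) ^ 2))"
  proof
    fix k
    have "(- \<i>) ^ Suc (2 * k + 1) = of_real ((-1) ^ Suc k)" by (simp add: power_mult)
    then have "Re ((- \<i>) ^ Suc (2 * k + 1)) = (-1) ^ Suc k" by (simp only: Re_complex_of_real)
    moreover have "real (Suc (2 * k + 1)) = 2 * (real k + 1)" by simp
    ultimately show "?f (2 * k + 1) = - (1 / 4) * ((-1) ^ k / (real k + 1) ^ 2)"
      unfolding expand by (simp only: power_mult_distrib) simp
  qed
  finally have "(\<lambda>k. - (1 / 4) * ((-1) ^ k / (real k + 1) ^ 2)) sums Re (dilog (- \<i>))" .
  from sums_unique2[OF this sums_mult[OF alternating_squares_sums]] show ?thesis by simp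
qed

lemma Im_dilog_ii: "Im (dilog \<i>) = catalan_const"
  using sums_unique2[OF Im_dilog_ii_sums[of 1]] catalan_sums by simp

lemma Im_dilog_minus_ii: "Im (dilog (- \<i>)) = - catalan_const"
  using sums_unique2[OF Im_dilog_ii_sums[of "-1"]] sums_minus[OF catalan_sums] by simp

lemma Ln_1_plus_ii:
  "Ln (1 + \<i> * of_real x) = Complex (ln (1 + x ^ 2) / 2) (arctan x)"
proof (rule complex_eqI)
  have "1 + x ^ 2 > 0" by (rule add_pos_nonneg) auto
  moreover have nz: "1 + \<i> * of_real x \<noteq> 0" by (simp add: complex_eq_iff)
  moreover have "norm (1 + \<i> * of_real x) = sqrt (1 + x ^ 2)" by (simp add: cmod_def)
  ultimately show "Re (Ln (1 + \<i> * of_real x)) = Re (Complex (ln (1 + x ^ 2) / 2) (arctan x))"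
    by (simp add: ln_sqrt)
  show "Im (Ln (1 + \<i> * of_real x)) = Im (Complex (ln (1 + x ^ 2) / 2) (arctan x))"
    using Im_Ln_eq[OF nz] by simp
qed

text \<open>Since 1 - (1 + i) = -i, reflection replaces Li_2(1 + i) by Li_2(-i), whose real and
  imaginary parts are known. Only the trilogarithm remains unevaluated.\<close>

lemma Im_log_square_primitive_1_plus_ii:
  "Im (log_square_primitive (1 + \<i>)) = pi * ln 2 ^ 2 / 8 + pi ^ 3 / 16 + ln 2 * catalan_const - 2 * Im (trilog (1 + \<i>))"
proof -
  have Ln: "Ln (1 + \<i>) = Complex (ln 2 / 2) (pi / 4)"
    using Ln_1_plus_ii[of 1] by (simp add: arctan_one)
  have Ln': "Ln (- \<i>) = Complex 0 (- (pi / 2))"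
    by (simp add: complex_eq_iff)
  have "1 + \<i> \<in> double_slit_plane" by (simp add: double_slit_plane_def)
  from dilog_reflection[OF this]
  have "dilog (1 + \<i>) + dilog (- \<i>) + Ln (1 + \<i>) * Ln (- \<i>) = of_real (pi ^ 2 / 6)"
    by simp
  then have "dilog (1 + \<i>) = of_real (pi ^ 2 / 6) - Ln (1 + \<i>) * Ln (- \<i>) - dilog (- \<i>)"
    by (simp only: eq_diff_eq)
  \<comment> \<open>The real part is pi^2/6 - pi^2/8 + pi^2/48.\<close>
  then have "dilog (1 + \<i>) = Complex (pi ^ 2 / 16) (catalan_const + pi * ln 2 / 4)"
    unfolding Ln Ln'
    by (simp add: complex_eq_iff Re_dilog_minus_ii Im_dilog_minus_ii power2_eq_square)
  then have val: "log_square_primitive (1 + \<i>) = Complex 0 (- (pi / 2)) * Complex (ln 2 / 2) (pi / 4) ^ 2 +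
      2 * Complex (ln 2 / 2) (pi / 4) * Complex (pi ^ 2 / 16) (catalan_const + pi * ln 2 / 4)
      - 2 * trilog (1 + \<i>)"
    using Ln' by (simp add: log_square_primitive_def Ln del: Ln_minus_ii)
  show ?thesis
    unfolding val by (simp add: power2_eq_square power3_eq_cube field_simps)
qed

subsection \<open>The base case of the recurrence\<close>

text \<open>The antiderivative of -x/(1 + x^2) Im Li_2(ix) given by integration by parts: a boundary
  term plus half of a primitive of ln(1 + x^2) arctan x / x.\<close>

definition tail_sum_curve :: "real \<Rightarrow> real" where
  "tail_sum_curve x = - (ln (1 + x ^ 2) / 2) * Im (dilog (\<i> * of_real x)) + Im (log_square_primitive (1 + \<i> * of_real x)) / 2"

lemma Im_dilog_ii_deriv:
  assumes "x \<noteq> 0"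
  shows "((\<lambda>x. Im (dilog (\<i> * of_real x))) has_real_derivative arctan x / x) (at x)"
proof -
  let ?D = "- Ln (1 - \<i> * of_real x) / (\<i> * of_real x)"
  have "(dilog has_field_derivative ?D) (at (\<i> * of_real x))"
    using assms by (intro dilog_has_field_derivative ii_times_in_slit_plane) auto
  moreover have "((\<lambda>x. \<i> * of_real x) has_vector_derivative \<i>) (at x)"
    by (auto intro!: derivative_eq_intros)
  ultimately have "((dilog \<circ> (\<lambda>x. \<i> * of_real x)) has_vector_derivative \<i> * ?D) (at x)"
    by (rule field_vector_diff_chain_at[rotated])
  then have "((\<lambda>x. Im (dilog (\<i> * of_real x))) has_real_derivative Im (\<i> * ?D)) (at x)"
    unfolding o_def by (rule has_field_derivative_Im)
  moreover have "\<i> * ?D = - Ln (1 + \<i> * of_real (- x)) / of_real x"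
    using assms by (simp add: field_simps)
  ultimately show ?thesis
    by (simp only: Ln_1_plus_ii Im_divide_of_real uminus_complex.sel complex.sel arctan_minus) simp
qed

lemma Im_log_square_primitive_deriv:
  assumes "x > 0"
  shows "((\<lambda>x. Im (log_square_primitive (1 + \<i> * of_real x))) has_real_derivative ln (1 + x ^ 2) * arctan x / x) (at x)"
proof -
  let ?z = "1 + \<i> * of_real x"
  let ?D = "- (Ln ?z ^ 2 / (1 - ?z))"
  have "(log_square_primitive has_field_derivative ?D) (at ?z)"
    using assms by (intro log_square_primitive_has_field_derivative) (auto simp: double_slit_plane_def)
  moreover have "((\<lambda>x. 1 + \<i> * of_real x) has_vector_derivative \<i>) (at x)"
    by (auto intro!: derivative_eq_intros)
  ultimately have "((log_square_primitive \<circ> (\<lambda>x. 1 + \<i> * of_real x)) has_vector_derivative \<i> * ?D) (at x)"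
    by (rule field_vector_diff_chain_at[rotated])
  then have "((\<lambda>x. Im (log_square_primitive (1 + \<i> * of_real x))) has_real_derivative Im (\<i> * ?D)) (at x)"
    unfolding o_def by (rule has_field_derivative_Im)
  \<comment> \<open>Here 1 - z = -ix, so the direction i of the path turns the derivative into (Ln
    z)^2 / x.\<close>
  moreover have "\<i> * ?D = Ln ?z ^ 2 / of_real x"
    using assms by (simp add: field_simps)
  moreover have "Im (Complex (ln (1 + x ^ 2) / 2) (arctan x) ^ 2) = ln (1 + x ^ 2) * arctan x"
    by (simp add: power2_eq_square)
  ultimately show ?thesis
    by (simp only: Ln_1_plus_ii Im_divide_of_real)
qed

lemma tail_sum_curve_deriv:
  assumes "x > 0"
  shows "(tail_sum_curve has_real_derivative - x / (1 + x ^ 2) * Im (dilog (\<i> * of_real x))) (at x)"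
proof -
  have pos: "1 + x ^ 2 > 0" by (rule add_pos_nonneg) auto
  have "((\<lambda>x. ln (1 + x ^ 2) / 2) has_real_derivative x / (1 + x ^ 2)) (at x)"
    using pos by (auto intro!: derivative_eq_intros simp: divide_simps)
  from DERIV_add[OF DERIV_mult[OF DERIV_minus[OF this] Im_dilog_ii_deriv]
      DERIV_cdivide[OF Im_log_square_primitive_deriv], of 2] assms
  have "(tail_sum_curve has_real_derivative - (x / (1 + x ^ 2)) * Im (dilog (\<i> * of_real x))
      + arctan x / x * - (ln (1 + x ^ 2) / 2) + ln (1 + x ^ 2) * arctan x / x / 2) (at x)"
    unfolding tail_sum_curve_def[abs_def] by simp
  then show ?thesis by (simp add: mult.commute)
qed

text \<open>The point x = 0 corresponds to the branch point 1, hence a one-sided limit. The limit -2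
  Li_3(1) of \<open>log_square_primitive\<close> is real, so its imaginary part drops out.\<close>

lemma tail_sum_curve_at_right_0: "(tail_sum_curve \<longlongrightarrow> 0) (at_right 0)"
proof -
  have "((\<lambda>x. \<i> * of_real x) \<longlongrightarrow> 0) (at_right (0::real))"
    by (intro tendsto_eq_intros) auto
  then have "((\<lambda>x. dilog (\<i> * of_real x)) \<longlongrightarrow> dilog 0) (at_right (0::real))"
    by (intro isCont_tendsto_compose[OF isCont_dilog]) (auto simp: slit_plane_iff)
  moreover have "((\<lambda>x::real. - (ln (1 + x ^ 2) / 2)) \<longlongrightarrow> 0) (at_right 0)"
    by real_asymp
  ultimately have "((\<lambda>x. - (ln (1 + x ^ 2) / 2) * Im (dilog (\<i> * of_real x)) + Im (log_square_primitive (1 + \<i> * of_real x)) / 2)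
      \<longlongrightarrow> 0 * Im (dilog 0) + Im (- 2 * polylog_series 3 1) / 2) (at_right (0::real))"
    by (intro tendsto_add tendsto_mult tendsto_divide tendsto_Im tendsto_const log_square_primitive_vertical_limit) auto
  moreover have "Im (polylog_series 3 1) = 0"
  proof -
    have "polylog_series 3 1 = (\<Sum>k. complex_of_real (1 / real (Suc k) ^ 3))"
      by (simp add: polylog_series_def)
    also have "\<dots> = of_real (\<Sum>k. 1 / real (Suc k) ^ 3)"
    proof (rule suminf_of_real[symmetric])
      have "summable (\<lambda>k. inverse (real (Suc k) ^ 3))"
        using inverse_power_summable[of 3, where 'a = real]
        by (subst summable_Suc_iff) auto
      then show "summable (\<lambda>k. 1 / real (Suc k) ^ 3)" by (simp only: inverse_eq_divide)
    qed
    finally show ?thesis by (simp only: Im_complex_of_real)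
  qed
  ultimately show ?thesis by (simp add: tail_sum_curve_def[abs_def])
qed

lemma tail_sum_curve_1:
  "tail_sum_curve 1 = pi * ln 2 ^ 2 / 16 + pi ^ 3 / 32 - Im (trilog (1 + \<i>))"
  using Im_log_square_primitive_1_plus_ii by (simp add: tail_sum_curve_def Im_dilog_ii field_simps)

text \<open>Both sides are the values at 1 of functions on the unit interval that vanish at 0 and
  have the same derivative.\<close>
lemma tail_sum_0: "tail_sum 0 = pi * ln 2 ^ 2 / 16 + pi ^ 3 / 32 - Im (trilog (1 + \<i>))"
proof -
  define f where "f k x = arctan_tail (Suc k) x / (2 * real k + 1) ^ 2" for k x
  define f' where "f' k x = (- (x ^ 2)) ^ Suc k / (1 + x ^ 2) / (2 * real k + 1) ^ 2" for k and x :: real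
  have f'_bound: "norm (f' k x) \<le> 1 / (2 * real k + 1) ^ 2" if "x \<in> {0..1}" for k x
  proof -
    have "\<bar>(- (x ^ 2)) ^ Suc k\<bar> \<le> 1"
      using that unfolding power_abs by (intro power_le_one) (auto simp: power_le_one)
    moreover have "1 + x ^ 2 \<ge> 1" by simp
    ultimately have "\<bar>(- (x ^ 2)) ^ Suc k / (1 + x ^ 2)\<bar> \<le> 1"
      unfolding abs_divide by (subst divide_le_eq_1_pos) linarith+
    then have "\<bar>(- (x ^ 2)) ^ Suc k / (1 + x ^ 2)\<bar> / (2 * real k + 1) ^ 2 \<le> 1 / (2 * real k + 1) ^ 2"
      by (rule divide_right_mono) simp
    then show ?thesis by (simp only: f'_def real_norm_def abs_divide abs_power2)
  qed
  \<comment> \<open>Termwise differentiation: the derivatives are dominated by inverse odd squares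
    uniformly on the closed interval, and at 0 every term of the series vanishes.\<close>
  have "\<exists>g. \<forall>x\<in>{0..1}. (\<lambda>k. f k x) sums g x \<and>
      (g has_real_derivative (\<Sum>k. f' k x)) (at x within {0..1})"
  proof (rule has_field_derivative_series)
    show "(f k has_real_derivative f' k x) (at x within {0..1})" for k x
      unfolding f_def[abs_def] f'_def
      by (intro DERIV_cdivide has_field_derivative_at_within[OF arctan_tail_deriv])
    show "uniform_limit {0..1} (\<lambda>n x. \<Sum>i<n. f' i x) (\<lambda>x. \<Sum>k. f' k x) sequentially"
      using f'_bound summable_odd_squares by (rule Weierstrass_m_test)
    show "summable (\<lambda>k. f k 0)" by (simp add: f_def)
  qed (auto intro: convex_real_interval)
  then obtain g where sums: "\<And>x. x \<in> {0..1} \<Longrightarrow> (\<lambda>k. f k x) sums g x"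
    and der: "\<And>x. x \<in> {0..1} \<Longrightarrow> (g has_real_derivative (\<Sum>k. f' k x)) (at x within {0..1})"
    by blast
  have g0: "g 0 = 0"
    using sums[of 0] by (simp add: f_def sums_iff)
  have g1: "g 1 = tail_sum 0"
    using sums[of 1] by (simp add: f_def tail_sum_def sums_iff)
  have cont: "continuous_on {0..1} g"
    using der by (rule DERIV_continuous_on)
  \<comment> \<open>One factor -x splits off (-x^2)^(k + 1), leaving (-1)^k x^(2k + 1), so the sum
    is a multiple of the series of Im Li_2(ix).\<close>
  have deriv_eq: "(\<Sum>k. f' k x) = - x / (1 + x ^ 2) * Im (dilog (\<i> * of_real x))" if "x \<in> {0<..<1}" for x
  proof -
    have "(\<lambda>k. - x / (1 + x ^ 2) * ((-1) ^ k * x ^ (2 * k + 1) / (2 * real k + 1) ^ 2)) sums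
        (- x / (1 + x ^ 2) * Im (dilog (\<i> * of_real x)))"
      using that by (intro sums_mult Im_dilog_ii_sums) auto
    moreover have "- x / (1 + x ^ 2) * ((-1) ^ k * x ^ (2 * k + 1) / (2 * real k + 1) ^ 2) = f' k x" for k
    proof -
      have "(- (x ^ 2)) ^ Suc k = (-1) ^ Suc k * (x * x ^ (2 * k + 1))"
        unfolding power_minus[of "x ^ 2"] power_mult[symmetric] by (simp add: power_add)
      then show ?thesis by (simp add: f'_def)
    qed
    ultimately show ?thesis by (simp add: sums_iff)
  qed
  \<comment> \<open>The comparison runs on the open interval and one-sided limits carry it to the
    endpoints: the limit at 0 gives c = 0, the limit at 1 gives the claim.\<close>
  have "\<exists>c. \<forall>x\<in>{0<..<1}. tail_sum_curve x - g x = c"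
  proof (rule has_field_derivative_zero_constant)
    fix x :: real assume x: "x \<in> {0<..<1}"
    have "(g has_real_derivative (\<Sum>k. f' k x)) (at x)"
      using der[of x] x by (simp add: at_within_Icc_at)
    then have "((\<lambda>x. tail_sum_curve x - g x) has_real_derivative 0) (at x)"
      using DERIV_diff[OF tail_sum_curve_deriv[of x]] deriv_eq[OF x] x by fastforce
    then show "((\<lambda>x. tail_sum_curve x - g x) has_real_derivative 0) (at x within {0<..<1})"
      by (rule has_field_derivative_at_within)
  qed auto
  then obtain c where c: "\<And>x. x \<in> {0<..<1} \<Longrightarrow> tail_sum_curve x - g x = c" by blast
  have "(g \<longlongrightarrow> g 0) (at_right 0)"
    using cont by (auto dest: continuous_on_Icc_at_rightD)
  then have "((\<lambda>x. tail_sum_curve x - g x) \<longlongrightarrow> 0 - g 0) (at_right 0)"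
    by (intro tendsto_diff tail_sum_curve_at_right_0)
  moreover have "\<forall>\<^sub>F x in at_right 0. tail_sum_curve x - g x = c"
    using eventually_at_right_real[of 0 1] by (auto elim!: eventually_mono intro: c)
  ultimately have "((\<lambda>x::real. c) \<longlongrightarrow> 0 - g 0) (at_right 0)"
    by (rule Lim_transform_eventually)
  then have c0: "c = 0" by (simp add: tendsto_const_iff g0)
  have "(tail_sum_curve \<longlongrightarrow> tail_sum_curve 1) (at_left 1)"
    using DERIV_isCont[OF tail_sum_curve_deriv[of 1]] by (auto simp: isCont_def intro: filterlim_mono at_le)
  moreover have "(g \<longlongrightarrow> g 1) (at_left 1)"
    using cont by (auto dest: continuous_on_Icc_at_leftD)
  ultimately have "((\<lambda>x. tail_sum_curve x - g x) \<longlongrightarrow> tail_sum_curve 1 - g 1) (at_left 1)"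
    by (rule tendsto_diff)
  moreover have "\<forall>\<^sub>F x in at_left 1. tail_sum_curve x - g x = c"
    using eventually_at_left_real[of 0 1] by (auto elim!: eventually_mono intro: c)
  ultimately have "((\<lambda>x::real. c) \<longlongrightarrow> tail_sum_curve 1 - g 1) (at_left 1)"
    by (rule Lim_transform_eventually)
  then have "tail_sum_curve 1 = g 1" by (simp add: tendsto_const_iff c0)
  then show ?thesis by (simp only: g1 tail_sum_curve_1)
qed

section \<open>Assembly of the four cases\<close>

theorem theorem4:
  fixes m n :: nat
  assumes "m \<ge> 1" and "n \<ge> 1" and "n \<ge> m"
  shows
   "(n = m \<longrightarrow>
      Theta2 m n = (-1) ^ m *
        (- 4
         - 4 * (\<Sum>k=1..m. \<Sum>j=0..k. (-1) ^ j / ((2 * real j + 1) * (2 * real k + 1) ^ 2))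
         + (1 - (ln 2) ^ 2 / 4 + (\<Sum>k=1..m. 1 / (2 * real k + 1) ^ 2)) * pi
         - pi ^ 3 / 8
         + 4 * Im (trilog (1 + \<i>))))
    \<and>
    (n = m + 1 \<longrightarrow>
      Theta2 m n = (-1) ^ m *
        (11 / 3
         + 4 * (\<Sum>k=1..m. \<Sum>j=0..k+1. (-1) ^ j / ((2 * real j + 1) * (2 * real k + 1) ^ 2))
         - 3 * pi / 2
         + ((ln 2) ^ 2 / 4 - (\<Sum>k=1..m. 1 / (2 * real k + 1) ^ 2)) * pi
         + pi ^ 3 / 8
         + 2 * catalan_const
         - 4 * Im (trilog (1 + \<i>))))
    \<and>
    (odd (n - m) \<and> n - m \<noteq> 1 \<longrightarrow>
      Theta2 m n = (-1) ^ m *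
        (5
         - (\<Sum>j=1..(n - m - 1) div 2. 1 / (4 * real j ^ 2 * (4 * real j + 1)))
         - 4 * (\<Sum>k=1..m. \<Sum>j=0..k+n-m.
                  (-1) ^ (j + n - m) / ((2 * real j + 1) * (2 * real k + 1) ^ 2))
         + 1 / 4 * (\<Sum>k=1..(n - m - 1) div 2. \<Sum>j=0..2*k.
                  (-1) ^ j * (8 * real k ^ 2 + 4 * real k + 1)
                    / (real k ^ 2 * (2 * real j + 1) * (2 * real k + 1) ^ 2))
         + 4 * (\<Sum>j=1..n-m. (-1) ^ j / (2 * real j + 1))
         + (2 - (\<Sum>j=1..(n - m - 1) div 2. 1 / (real j * (2 * real j + 1)))) * catalan_const
         + ((ln 2) ^ 2 / 4 - 3 / 2
            + (-1) ^ (n - m) * (\<Sum>j=1..m. 1 / (2 * real j + 1) ^ 2)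
            - 1 / 2 * (\<Sum>j=1..(n - m - 1) div 2. 1 / (2 * real j + 1) ^ 2)) * pi
         + pi ^ 3 / 8
         - 4 * Im (trilog (1 + \<i>))))
    \<and>
    (even (n - m) \<longrightarrow>
      Theta2 m n = (-1) ^ m *
        (- 4
         + 1 / 4 * (\<Sum>j=1..(n - m) div 2. 1 / (real j ^ 2 * (4 * real j - 1)))
         - 4 * (\<Sum>k=1..m. \<Sum>j=0..k+n-m.
                  (-1) ^ (j + n - m) / ((2 * real j + 1) * (2 * real k + 1) ^ 2))
         - 1 / 4 * (\<Sum>k=1..(n - m) div 2. \<Sum>j=0..2*k-2.
                  (-1) ^ j * (8 * real k ^ 2 - 4 * real k + 1)
                    / (real k ^ 2 * (2 * real j + 1) * (2 * real k - 1) ^ 2))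
         - 4 * (\<Sum>j=1..n-m. (-1) ^ j / (2 * real j + 1))
         + (1 + (-1) ^ (n - m) * (\<Sum>j=1..m. 1 / (2 * real j + 1) ^ 2)
            + 1 / 2 * (\<Sum>j=1..(n - m) div 2. 1 / (2 * real j - 1) ^ 2)) * pi
         - pi / 4 * (ln 2) ^ 2
         - pi ^ 3 / 8
         - catalan_const * (\<Sum>j=1..(n - m) div 2. 1 / (real j * (2 * real j - 1)))
         + 4 * Im (trilog (1 + \<i>))))"
proof -
  define d where "d = n - m"
  have n: "n = m + d" using assms(3) by (simp add: d_def)
  define L where "L = Im (trilog (1 + \<i>))"
  define A where "A = (\<Sum>k=1..m. \<Sum>j=0..k+d. (-1) ^ j / ((2 * real j + 1) * (2 * real k + 1) ^ 2))"
  define B where "B = (\<Sum>j=1..m. 1 / (2 * real j + 1) ^ 2)"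
  define C where "C = (\<Sum>j=1..d. (-1) ^ j / (2 * real j + 1))"
  have sign: "(\<Sum>k=1..m. \<Sum>j=0..k+d. (-1) ^ (j + d) / ((2 * real j + 1) * (2 * real k + 1) ^ 2)) = (-1) ^ d * A"
    by (simp add: A_def sum_distrib_left power_add mult_ac)
  \<comment> \<open>The sign -(-1)^d leaves -4 \<open>tail_sum d\<close> for even d and 4
    \<open>tail_sum d\<close> for odd d, the multiples in which \<open>tail_sum_even\<close> and
    \<open>tail_sum_odd\<close> are stated.\<close>
  have Theta: "Theta2 m n = (-1) ^ m * (- ((-1) ^ d * (4 * tail_sum d - (pi - 4 - 4 * C + pi * B - 4 * A))))"
    unfolding n Theta2_eq_tail_sum A_def B_def C_def sum_arctan_tail[symmetric]
    by (simp add: power_add right_diff_distrib)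
  have S0: "tail_sum 0 = pi * ln 2 ^ 2 / 16 + pi ^ 3 / 32 - L"
    unfolding L_def by (rule tail_sum_0)
  have even_case: "Theta2 m n = (-1) ^ m * (- 4
         + 1 / 4 * (\<Sum>j=1..d div 2. 1 / (real j ^ 2 * (4 * real j - 1)))
         - 4 * ((-1) ^ d * A)
         - 1 / 4 * (\<Sum>k=1..d div 2. \<Sum>j=0..2*k-2.
                  (-1) ^ j * (8 * real k ^ 2 - 4 * real k + 1)
                    / (real k ^ 2 * (2 * real j + 1) * (2 * real k - 1) ^ 2))
         - 4 * C
         + (1 + (-1) ^ d * B + 1 / 2 * (\<Sum>j=1..d div 2. 1 / (2 * real j - 1) ^ 2)) * pi
         - pi / 4 * (ln 2) ^ 2 - pi ^ 3 / 8
         - catalan_const * (\<Sum>j=1..d div 2. 1 / (real j * (2 * real j - 1)))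
         + 4 * L)" if "even d"
    unfolding Theta using that tail_sum_even[of "d div 2"]
    by (simp add: S0) (simp add: algebra_simps)
  have odd_case: "Theta2 m n = (-1) ^ m * (5
         - (\<Sum>j=1..(d - 1) div 2. 1 / (4 * real j ^ 2 * (4 * real j + 1)))
         - 4 * ((-1) ^ d * A)
         + 1 / 4 * (\<Sum>k=1..(d - 1) div 2. \<Sum>j=0..2*k.
                  (-1) ^ j * (8 * real k ^ 2 + 4 * real k + 1)
                    / (real k ^ 2 * (2 * real j + 1) * (2 * real k + 1) ^ 2))
         + 4 * C
         + (2 - (\<Sum>j=1..(d - 1) div 2. 1 / (real j * (2 * real j + 1)))) * catalan_const
         + ((ln 2) ^ 2 / 4 - 3 / 2 + (-1) ^ d * B
            - 1 / 2 * (\<Sum>j=1..(d - 1) div 2. 1 / (2 * real j + 1) ^ 2)) * pi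
         + pi ^ 3 / 8 - 4 * L)" if "odd d"
  proof -
    have "2 * ((d - 1) div 2) + 1 = d" using that by presburger
    then show ?thesis
      unfolding Theta using that tail_sum_odd[of "(d - 1) div 2"]
      by (simp add: S0) (simp add: algebra_simps)
  qed
  \<comment> \<open>The first two cases are the parity formulas at d = 0 and d = 1, where the sums
    up to half of d are empty; for d = 1 the constant is 5 + 4 C = 5 - 4/3 = 11/3.\<close>
  show ?thesis
  proof (intro conjI impI, goal_cases)
    case 1
    then show ?case using even_case by (simp add: A_def B_def C_def L_def d_def algebra_simps)
  next
    case 2
    then show ?case using odd_case by (simp add: A_def B_def C_def L_def d_def algebra_simps)
  next
    case 3
    \<comment> \<open>The bound \<open>n \<ge> m\<close> turns the truncated differences
      \<open>k + n - m\<close> and \<open>j + n - m\<close> into \<open>k + d\<close> and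
      \<open>j + d\<close>.\<close>
    then show ?case using odd_case sign assms(3) unfolding A_def B_def C_def L_def d_def by simp
  next
    case 4
    then show ?case using even_case sign assms(3) unfolding A_def B_def C_def L_def d_def by simp
  qed
qed

end
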